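(* Let $(M,g,I)$ be a Hermitian manifold and let $H=H^{2,1}+\overline{H^{2,1}}$ be a real three-form on $M$ of type $(1,2)+(2,1)$ such that $\overline{\partial}H^{2,1}=0$. Then $\nabla^{Ch}+\frac12 I[g^{-1}H,I]$ is a metric connection on $TM$ with $(1,1)$ curvature.
   Context: $H^{2,1}$ is the $(2,1)$ part of $H$. $\nabla^{Ch}$ is the Chern connection on $TM$ (for the Hermitian metric $g$ and the holomorphic structure determined by $I$), viewed as a real connection. $g^{-1}H$ is the $\mathrm{End}(TM)$-valued one-form $v\mapsto g^{-1}H_v$ defined by $g(g^{-1}H_vw,u)=H(v,w,u)$, and $I[g^{-1}H,I]$ is the $\mathrm{End}(TM)$-valued one-form $v\mapsto I\,(g^{-1}H_v\,I-I\,g^{-1}H_v)$. A metric connection is one preserving $g$. A connection $\nabla$ has $(1,1)$ curvature if $R^\nabla(Iv,Iw)=R^\nabla(v,w)$ for all $v,w$. *)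

theory Defs
  imports "HOL-Analysis.Analysis" "HOL-Library.Function_Algebras"
begin

text \<open>
  Smooth manifolds are given by a smooth atlas on a second countable Hausdorff space (the type
  \<open>'m\<close>). Vector fields are the derivations of the algebra of smooth functions, and tensor
  fields and connections are maps on vector fields that are additive and, where required,
  homogeneous over smooth functions. Functions, and operators on functions, are added and
  multiplied pointwise.
\<close>

section \<open>Smooth manifolds\<close>

primrec Ck_on :: "nat \<Rightarrow> 'e set \<Rightarrow> ('e::euclidean_space \<Rightarrow> 'b::real_normed_vector) \<Rightarrow> bool" where
  "Ck_on 0 S f \<longleftrightarrow> continuous_on S f"
| "Ck_on (Suc k) S f \<longleftrightarrow>
     f differentiable_on S \<and> (\<forall>v. Ck_on k S (\<lambda>x. frechet_derivative f (at x) v))"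

text \<open>Both predicates are only used for open \<open>S\<close>.\<close>

definition smooth_on :: "'e set \<Rightarrow> ('e::euclidean_space \<Rightarrow> 'b::real_normed_vector) \<Rightarrow> bool" where
  "smooth_on S f \<longleftrightarrow> (\<forall>k. Ck_on k S f)"

type_synonym ('m, 'e) atlas = "('m set \<times> ('m \<Rightarrow> 'e)) set"

definition smooth_atlas ::
    "('m::{t2_space, second_countable_topology}, 'e::euclidean_space) atlas \<Rightarrow> bool" where
  "smooth_atlas \<A> \<longleftrightarrow>
     (\<Union>(U, \<phi>)\<in>\<A>. U) = UNIV \<and>
     (\<forall>(U, \<phi>)\<in>\<A>. open U \<and> open (\<phi> ` U) \<and> homeomorphism U (\<phi> ` U) \<phi> (inv_into U \<phi>)) \<and>
     (\<forall>(U, \<phi>)\<in>\<A>. \<forall>(V, \<psi>)\<in>\<A>. smooth_on (\<phi> ` (U \<inter> V)) (\<psi> \<circ> inv_into U \<phi>))"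

definition smooth_fun ::
    "('m, 'e::euclidean_space) atlas \<Rightarrow> ('m \<Rightarrow> 'b::real_normed_vector) \<Rightarrow> bool" where
  "smooth_fun \<A> f \<longleftrightarrow> (\<forall>(U, \<phi>)\<in>\<A>. smooth_on (\<phi> ` U) (f \<circ> inv_into U \<phi>))"

section \<open>Vector fields\<close>

type_synonym 'm vfield = "('m \<Rightarrow> real) \<Rightarrow> ('m \<Rightarrow> real)"

text \<open>The value on non-smooth functions is fixed to be \<open>0\<close>, so that equality of derivations on
  smooth functions is equality in HOL.\<close>

definition vector_fields :: "('m, 'e::euclidean_space) atlas \<Rightarrow> 'm vfield set" where
  "vector_fields \<A> = {X.
     (\<forall>f. smooth_fun \<A> f \<longrightarrow> smooth_fun \<A> (X f)) \<and>
     (\<forall>f g. smooth_fun \<A> f \<longrightarrow> smooth_fun \<A> g \<longrightarrow> X (f + g) = X f + X g) \<and>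
     (\<forall>c f. smooth_fun \<A> f \<longrightarrow> X ((\<lambda>_. c) * f) = (\<lambda>_. c) * X f) \<and>
     (\<forall>f g. smooth_fun \<A> f \<longrightarrow> smooth_fun \<A> g \<longrightarrow> X (f * g) = X f * g + f * X g) \<and>
     (\<forall>f. \<not> smooth_fun \<A> f \<longrightarrow> X f = 0)}"

definition fscale :: "('m \<Rightarrow> real) \<Rightarrow> 'm vfield \<Rightarrow> 'm vfield" (infixr "\<odot>" 75) where
  "h \<odot> X = (\<lambda>f. h * X f)"

definition lie :: "'m vfield \<Rightarrow> 'm vfield \<Rightarrow> 'm vfield" where
  "lie X Y = (\<lambda>f. X (Y f) - Y (X f))"

section \<open>Hermitian manifolds\<close>

text \<open>Positivity: the value of \<open>X\<close> at \<open>p\<close> is a nonzero tangent vector iff \<open>X f p \<noteq> 0\<close> for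
  some function \<open>f\<close>.\<close>

definition riemannian_metric ::
    "('m, 'e::euclidean_space) atlas \<Rightarrow> ('m vfield \<Rightarrow> 'm vfield \<Rightarrow> ('m \<Rightarrow> real)) \<Rightarrow> bool" where
  "riemannian_metric \<A> g \<longleftrightarrow>
     (\<forall>X\<in>vector_fields \<A>. \<forall>Y\<in>vector_fields \<A>. smooth_fun \<A> (g X Y) \<and> g X Y = g Y X) \<and>
     (\<forall>X\<in>vector_fields \<A>. \<forall>Y\<in>vector_fields \<A>. \<forall>Z\<in>vector_fields \<A>.
        g (X + Y) Z = g X Z + g Y Z) \<and>
     (\<forall>h. \<forall>X\<in>vector_fields \<A>. \<forall>Y\<in>vector_fields \<A>.
        smooth_fun \<A> h \<longrightarrow> g (h \<odot> X) Y = h * g X Y) \<and>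
     (\<forall>X\<in>vector_fields \<A>. \<forall>p. (\<exists>f. X f p \<noteq> 0) \<longrightarrow> g X X p > 0)"

definition almost_complex_structure ::
    "('m, 'e::euclidean_space) atlas \<Rightarrow> ('m vfield \<Rightarrow> 'm vfield) \<Rightarrow> bool" where
  "almost_complex_structure \<A> I \<longleftrightarrow>
     (\<forall>X\<in>vector_fields \<A>. I X \<in> vector_fields \<A> \<and> I (I X) = - X) \<and>
     (\<forall>X\<in>vector_fields \<A>. \<forall>Y\<in>vector_fields \<A>. I (X + Y) = I X + I Y) \<and>
     (\<forall>h. \<forall>X\<in>vector_fields \<A>. smooth_fun \<A> h \<longrightarrow> I (h \<odot> X) = h \<odot> I X)"

definition nijenhuis ::
    "('m vfield \<Rightarrow> 'm vfield) \<Rightarrow> 'm vfield \<Rightarrow> 'm vfield \<Rightarrow> 'm vfield" where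
  "nijenhuis I X Y = lie (I X) (I Y) - I (lie (I X) Y) - I (lie X (I Y)) - lie X Y"

definition complex_structure ::
    "('m, 'e::euclidean_space) atlas \<Rightarrow> ('m vfield \<Rightarrow> 'm vfield) \<Rightarrow> bool" where
  "complex_structure \<A> I \<longleftrightarrow> almost_complex_structure \<A> I \<and>
     (\<forall>X\<in>vector_fields \<A>. \<forall>Y\<in>vector_fields \<A>. nijenhuis I X Y = 0)"

definition hermitian_manifold ::
    "('m::{t2_space, second_countable_topology}, 'e::euclidean_space) atlas \<Rightarrow>
     ('m vfield \<Rightarrow> 'm vfield \<Rightarrow> ('m \<Rightarrow> real)) \<Rightarrow> ('m vfield \<Rightarrow> 'm vfield) \<Rightarrow> bool" where
  "hermitian_manifold \<A> g I \<longleftrightarrow>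
     smooth_atlas \<A> \<and> riemannian_metric \<A> g \<and> complex_structure \<A> I \<and>
     (\<forall>X\<in>vector_fields \<A>. \<forall>Y\<in>vector_fields \<A>. g (I X) (I Y) = g X Y)"

section \<open>Complexified tangent bundle\<close>

text \<open>A complex vector field \<open>X + \<i> Y\<close> is represented by the pair \<open>(X, Y)\<close>; addition and negation
  of pairs are componentwise.\<close>

type_synonym 'm cvfield = "'m vfield \<times> 'm vfield"

definition cv_i :: "'m cvfield \<Rightarrow> 'm cvfield" where
  "cv_i Z = (- snd Z, fst Z)"

definition cv_half :: "'m cvfield \<Rightarrow> 'm cvfield" where
  "cv_half Z = ((\<lambda>_. 1/2) \<odot> fst Z, (\<lambda>_. 1/2) \<odot> snd Z)"

definition cv_bilinear ::
    "('m vfield \<Rightarrow> 'm vfield \<Rightarrow> 'm vfield) \<Rightarrow> 'm cvfield \<Rightarrow> 'm cvfield \<Rightarrow> 'm cvfield" where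
  "cv_bilinear B Z W =
     (B (fst Z) (fst W) - B (snd Z) (snd W), B (fst Z) (snd W) + B (snd Z) (fst W))"

definition T10 :: "('m, 'e::euclidean_space) atlas \<Rightarrow> ('m vfield \<Rightarrow> 'm vfield) \<Rightarrow> 'm cvfield set" where
  "T10 \<A> I = {Z \<in> vector_fields \<A> \<times> vector_fields \<A>. map_prod I I Z = cv_i Z}"

definition T01 :: "('m, 'e::euclidean_space) atlas \<Rightarrow> ('m vfield \<Rightarrow> 'm vfield) \<Rightarrow> 'm cvfield set" where
  "T01 \<A> I = {Z \<in> vector_fields \<A> \<times> vector_fields \<A>. map_prod I I Z = - cv_i Z}"

definition proj10 :: "('m vfield \<Rightarrow> 'm vfield) \<Rightarrow> 'm cvfield \<Rightarrow> 'm cvfield" where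
  "proj10 I Z = cv_half (Z - cv_i (map_prod I I Z))"

definition proj01 :: "('m vfield \<Rightarrow> 'm vfield) \<Rightarrow> 'm cvfield \<Rightarrow> 'm cvfield" where
  "proj01 I Z = cv_half (Z + cv_i (map_prod I I Z))"

section \<open>Differential forms\<close>

text \<open>A \<open>k\<close>-form is evaluated on lists of \<open>k\<close> real vector fields. Complex-valued forms take
  complex values on real vector fields.\<close>

definition k_form ::
    "('m, 'e::euclidean_space) atlas \<Rightarrow> nat \<Rightarrow> ('m vfield list \<Rightarrow> ('m \<Rightarrow> real)) \<Rightarrow> bool" where
  "k_form \<A> k \<alpha> \<longleftrightarrow> (\<forall>Xs. length Xs = k \<and> set Xs \<subseteq> vector_fields \<A> \<longrightarrow>
     smooth_fun \<A> (\<alpha> Xs) \<and>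
     (\<forall>i<k. \<forall>X\<in>vector_fields \<A>. \<forall>Y\<in>vector_fields \<A>.
        \<alpha> (Xs[i := X + Y]) = \<alpha> (Xs[i := X]) + \<alpha> (Xs[i := Y])) \<and>
     (\<forall>i<k. \<forall>h. \<forall>X\<in>vector_fields \<A>.
        smooth_fun \<A> h \<longrightarrow> \<alpha> (Xs[i := h \<odot> X]) = h * \<alpha> (Xs[i := X])) \<and>
     (\<forall>i<k. \<forall>j<k. i \<noteq> j \<and> Xs ! i = Xs ! j \<longrightarrow> \<alpha> Xs = 0))"

definition complexify ::
    "('m vfield list \<Rightarrow> ('m \<Rightarrow> real)) \<Rightarrow> 'm vfield list \<Rightarrow> ('m \<Rightarrow> complex)" where
  "complexify \<alpha> Xs = (\<lambda>x. complex_of_real (\<alpha> Xs x))"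

text \<open>Complex-multilinear extension to complex vector fields; \<open>S\<close> is the set of slots in which
  the imaginary part is taken.\<close>

definition cv_eval ::
    "('m vfield list \<Rightarrow> ('m \<Rightarrow> complex)) \<Rightarrow> 'm cvfield list \<Rightarrow> ('m \<Rightarrow> complex)" where
  "cv_eval \<alpha> Zs = (\<lambda>x. \<Sum>S\<in>Pow {..<length Zs}. \<i> ^ card S *
     \<alpha> (map (\<lambda>j. if j \<in> S then snd (Zs ! j) else fst (Zs ! j)) [0..<length Zs]) x)"

text \<open>The \<open>(p,q)\<close> part of a \<open>(p+q)\<close>-form; \<open>S\<close> is the set of slots projected to type \<open>(1,0)\<close>.\<close>

definition type_part ::
    "('m vfield \<Rightarrow> 'm vfield) \<Rightarrow> nat \<Rightarrow> nat \<Rightarrow> ('m vfield list \<Rightarrow> ('m \<Rightarrow> complex)) \<Rightarrow>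
     'm vfield list \<Rightarrow> ('m \<Rightarrow> complex)" where
  "type_part I p q \<alpha> Xs = (if length Xs = p + q
     then (\<lambda>x. \<Sum>S | S \<subseteq> {..<p + q} \<and> card S = p.
        cv_eval \<alpha> (map (\<lambda>j. if j \<in> S then proj10 I (Xs ! j, 0) else proj01 I (Xs ! j, 0))
          [0..<p + q]) x)
     else 0)"

definition vf_act :: "'m vfield \<Rightarrow> ('m \<Rightarrow> complex) \<Rightarrow> ('m \<Rightarrow> complex)" where
  "vf_act X f = (\<lambda>x. Complex (X (\<lambda>y. Re (f y)) x) (X (\<lambda>y. Im (f y)) x))"

definition ext_d ::
    "('m vfield list \<Rightarrow> ('m \<Rightarrow> complex)) \<Rightarrow> 'm vfield list \<Rightarrow> ('m \<Rightarrow> complex)" where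
  "ext_d \<alpha> Xs = (\<lambda>x.
     (\<Sum>i<length Xs. (-1) ^ i * vf_act (Xs ! i) (\<alpha> (nths Xs (- {i}))) x) +
     (\<Sum>j<length Xs. \<Sum>i<j.
        (-1) ^ (i + j) * \<alpha> (lie (Xs ! i) (Xs ! j) # nths Xs (- {i, j})) x))"

text \<open>The Dolbeault operator on forms of type \<open>(p,q)\<close>.\<close>

definition dbar ::
    "('m vfield \<Rightarrow> 'm vfield) \<Rightarrow> nat \<Rightarrow> nat \<Rightarrow> ('m vfield list \<Rightarrow> ('m \<Rightarrow> complex)) \<Rightarrow>
     'm vfield list \<Rightarrow> ('m \<Rightarrow> complex)" where
  "dbar I p q \<alpha> = type_part I p (q + 1) (ext_d \<alpha>)"

section \<open>Connections on the tangent bundle\<close>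

definition connection ::
    "('m, 'e::euclidean_space) atlas \<Rightarrow> ('m vfield \<Rightarrow> 'm vfield \<Rightarrow> 'm vfield) \<Rightarrow> bool" where
  "connection \<A> D \<longleftrightarrow>
     (\<forall>X\<in>vector_fields \<A>. \<forall>Y\<in>vector_fields \<A>. D X Y \<in> vector_fields \<A>) \<and>
     (\<forall>X\<in>vector_fields \<A>. \<forall>Y\<in>vector_fields \<A>. \<forall>Z\<in>vector_fields \<A>.
        D (X + Y) Z = D X Z + D Y Z \<and> D X (Y + Z) = D X Y + D X Z) \<and>
     (\<forall>h. \<forall>X\<in>vector_fields \<A>. \<forall>Y\<in>vector_fields \<A>. smooth_fun \<A> h \<longrightarrow>
        D (h \<odot> X) Y = h \<odot> D X Y \<and> D X (h \<odot> Y) = X h \<odot> Y + h \<odot> D X Y)"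

definition metric_connection ::
    "('m, 'e::euclidean_space) atlas \<Rightarrow> ('m vfield \<Rightarrow> 'm vfield \<Rightarrow> ('m \<Rightarrow> real)) \<Rightarrow>
     ('m vfield \<Rightarrow> 'm vfield \<Rightarrow> 'm vfield) \<Rightarrow> bool" where
  "metric_connection \<A> g D \<longleftrightarrow> connection \<A> D \<and>
     (\<forall>X\<in>vector_fields \<A>. \<forall>Y\<in>vector_fields \<A>. \<forall>Z\<in>vector_fields \<A>.
        X (g Y Z) = g (D X Y) Z + g Y (D X Z))"

definition curvature ::
    "('m vfield \<Rightarrow> 'm vfield \<Rightarrow> 'm vfield) \<Rightarrow> 'm vfield \<Rightarrow> 'm vfield \<Rightarrow> 'm vfield \<Rightarrow> 'm vfield" where
  "curvature D X Y Z = D X (D Y Z) - D Y (D X Z) - D (lie X Y) Z"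

definition curvature_11 ::
    "('m, 'e::euclidean_space) atlas \<Rightarrow> ('m vfield \<Rightarrow> 'm vfield) \<Rightarrow>
     ('m vfield \<Rightarrow> 'm vfield \<Rightarrow> 'm vfield) \<Rightarrow> bool" where
  "curvature_11 \<A> I D \<longleftrightarrow>
     (\<forall>v\<in>vector_fields \<A>. \<forall>w\<in>vector_fields \<A>. \<forall>Z\<in>vector_fields \<A>.
        curvature D (I v) (I w) Z = curvature D v w Z)"

text \<open>The holomorphic structure of \<open>T\<^sup>1\<^sup>,\<^sup>0M\<close>: for \<open>V\<close> of type \<open>(0,1)\<close> and \<open>W\<close> of type \<open>(1,0)\<close>,
  its Dolbeault operator is \<open>[V, W]\<^sup>1\<^sup>,\<^sup>0\<close>. It annihilates the coordinate fields
  \<open>\<partial>/\<partial>z\<^sub>i\<close>. The Chern connection is the Hermitian connection on \<open>T\<^sup>1\<^sup>,\<^sup>0M\<close> whose \<open>(0,1)\<close> part is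
  this operator; as a real connection on \<open>TM\<close> it preserves \<open>g\<close> and \<open>I\<close>.\<close>

definition dbar_T10 ::
    "('m vfield \<Rightarrow> 'm vfield) \<Rightarrow> 'm cvfield \<Rightarrow> 'm cvfield \<Rightarrow> 'm cvfield" where
  "dbar_T10 I V W = proj10 I (cv_bilinear lie V W)"

definition chern_connection ::
    "('m, 'e::euclidean_space) atlas \<Rightarrow> ('m vfield \<Rightarrow> 'm vfield \<Rightarrow> ('m \<Rightarrow> real)) \<Rightarrow>
     ('m vfield \<Rightarrow> 'm vfield) \<Rightarrow> ('m vfield \<Rightarrow> 'm vfield \<Rightarrow> 'm vfield) \<Rightarrow> bool" where
  "chern_connection \<A> g I D \<longleftrightarrow> metric_connection \<A> g D \<and>
     (\<forall>X\<in>vector_fields \<A>. \<forall>Y\<in>vector_fields \<A>. D X (I Y) = I (D X Y)) \<and>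
     (\<forall>V\<in>T01 \<A> I. \<forall>W\<in>T10 \<A> I. cv_bilinear D V W = dbar_T10 I V W)"

text \<open>\<open>A\<close> is \<open>g\<^sup>-\<^sup>1H\<close>, with \<open>A v w\<close> standing for \<open>g\<^sup>-\<^sup>1H\<^sub>v w\<close>; it is determined by \<open>g\<close> and \<open>H\<close>.\<close>

definition is_ginv ::
    "('m, 'e::euclidean_space) atlas \<Rightarrow> ('m vfield \<Rightarrow> 'm vfield \<Rightarrow> ('m \<Rightarrow> real)) \<Rightarrow>
     ('m vfield list \<Rightarrow> ('m \<Rightarrow> real)) \<Rightarrow> ('m vfield \<Rightarrow> 'm vfield \<Rightarrow> 'm vfield) \<Rightarrow> bool" where
  "is_ginv \<A> g H A \<longleftrightarrow>
     (\<forall>v\<in>vector_fields \<A>. \<forall>w\<in>vector_fields \<A>. A v w \<in> vector_fields \<A> \<and>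
        (\<forall>u\<in>vector_fields \<A>. g (A v w) u = H [v, w, u]))"

text \<open>\<open>I[A, I]\<close> for an endomorphism-valued one-form \<open>A\<close>.\<close>

definition I_comm ::
    "('m vfield \<Rightarrow> 'm vfield) \<Rightarrow> ('m vfield \<Rightarrow> 'm vfield \<Rightarrow> 'm vfield) \<Rightarrow>
     'm vfield \<Rightarrow> 'm vfield \<Rightarrow> 'm vfield" where
  "I_comm I A v w = I (A v (I w) - I (A v w))"

end

theory Submission
  imports Defs
begin

text \<open>
  Write $T_v = \frac12 I[g^{-1}H_v, I]$, so that the connection in question is $D' = D + T$ with
  \<open>D\<close> the Chern connection. On the complexified tangent bundle $T_V$, for \<open>V\<close> of type (0,1), sends
  (1,0) vectors to (0,1) vectors and kills the latter, and under the identification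
  of $T^{0,1}$ with the dual of $T^{1,0}$ given by \<open>g\<close> it is the contraction $H^{2,1}(V,\cdot,\cdot)$.
  Hence the (0,1) part of $D'$ is the direct sum of the Dolbeault operators of
  $T^{1,0}$ and its dual, modified by a triangular term, and it squares to zero exactly when
  that term is closed under the Dolbeault operator. So $\overline\partial H^{2,1} = 0$ gives the
  vanishing of the (0,2) curvature, and reality that of the (2,0) curvature.

  The formal proof does this over the real numbers: \<open>TM\<close> is a complex bundle via \<open>I\<close>, and a
  condition on vectors of type (1,0) and (0,1) is a combination of values at real vectors with
  \<open>I\<close> inserted. Since $R' = R + d^D T + [T,T]$, three facts are combined.

  \<^item> The Chern curvature is of type (1,1) (\<open>chern_curvature_11\<close>). The operator
    $z \mapsto D_v z + I D_{Iv} z$ equals $z \mapsto [v,z] + I[Iv,z]$ because the (0,1) part of \<open>D\<close> is the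
    holomorphic structure, and this squares to zero by the Jacobi identity. The result is that
    an endomorphism \<open>P\<close>, skew for \<open>g\<close>, equals \<open>- I Q\<close> with \<open>Q\<close> skew and \<open>I\<close>-linear; then \<open>P\<close> is
    also symmetric, hence zero.

  \<^item> The type of \<open>H\<close> gives $T_{Iv} = I T_v = - T_v I$ (\<open>T_I1\<close>, \<open>T_I2\<close>), so that \<open>[T,T]\<close> is of
    type (1,1).

  \<^item> The defect of $d^D T$ from being of type (1,1) is, after lowering an index, half of
    \<open>dbar_h\<close>, the real form of $\overline\partial H^{2,1}$. Writing $H^{2,1} = \frac12(H - iK)$ with
    $K = H(I\cdot,I\cdot,I\cdot)$, the hypothesis says that \<open>dH\<close> and \<open>dK\<close> have no (2,2) part
    (\<open>dF_no_22_part_if_dbar_zero\<close>), and a combination of values of \<open>dH\<close> and \<open>dK\<close> is equal to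
    \<open>dbar_h\<close> (\<open>dF_dK_eq_dbar_h\<close>, \<open>dbar_h_zero\<close>).

  No local coordinates occur: a vector field is determined by its inner products with all vector
  fields (\<open>vfield_eqI\<close>), and identities between fields defined through \<open>g\<close> and \<open>H\<close> are tested in
  this way. The three-form \<open>H\<close>, as a function of three arguments, is called \<open>F\<close>.\<close>

section \<open>Smooth functions\<close>

text \<open>On an open set the Frechet derivative depends only on the values in that set. The
  congruence is what allows the product rule, which holds only at points of \<open>S\<close>, to be used
  below the predicate.\<close>

lemma Ck_on_cong:
  assumes "open S" "\<And>x. x \<in> S \<Longrightarrow> f x = g x" "Ck_on k S f"
  shows "Ck_on k S g"
  using assms(2,3)
proof (induction k arbitrary: f g)
  case 0
  then show ?case by (simp cong: continuous_on_cong)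
next
  case (Suc k)
  have d: "(g has_derivative frechet_derivative f (at x)) (at x)" if "x \<in> S" for x
  proof (rule has_derivative_transform_within_open[OF _ assms(1) that])
    have "f differentiable at x"
      using Suc.prems(2) that assms(1) by (simp add: differentiable_on_eq_differentiable_at)
    then show "(f has_derivative frechet_derivative f (at x)) (at x)"
      by (simp only: frechet_derivative_works)
  qed (use Suc.prems(1) in auto)
  have "g differentiable_on S"
    using d assms(1) by (auto simp: differentiable_on_eq_differentiable_at differentiable_def)
  moreover have "Ck_on k S (\<lambda>x. frechet_derivative g (at x) v)" for v
  proof (rule Suc.IH)
    show "frechet_derivative f (at x) v = frechet_derivative g (at x) v" if "x \<in> S" for x
      using frechet_derivative_at[OF d[OF that]] by simp
    show "Ck_on k S (\<lambda>x. frechet_derivative f (at x) v)"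
      using Suc.prems(2) by simp
  qed
  ultimately show ?case by simp
qed

lemma Ck_on_Suc_imp: "Ck_on (Suc k) S f \<Longrightarrow> Ck_on k S f"
proof (induction k arbitrary: f)
  case 0
  then show ?case by (simp add: differentiable_imp_continuous_on)
next
  case (Suc k)
  then show ?case by (metis Ck_on.simps(2))
qed

lemma Ck_on_const: "Ck_on k S (\<lambda>_. c)"
proof (induction k arbitrary: c)
  case (Suc k)
  then show ?case by (simp add: frechet_derivative_const)
qed simp

lemma frechet_derivative_add:
  assumes "f differentiable at x" "g differentiable at x"
  shows "frechet_derivative (\<lambda>x. f x + g x) (at x) v
      = frechet_derivative f (at x) v + frechet_derivative g (at x) v"
  using frechet_derivative_at[OF has_derivative_add[OF
        assms[unfolded frechet_derivative_works]], THEN fun_cong, of v] by simp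

lemma frechet_derivative_times:
  fixes f g :: "'e::real_normed_vector \<Rightarrow> real"
  assumes "f differentiable at x" "g differentiable at x"
  shows "frechet_derivative (\<lambda>x. f x * g x) (at x) v
      = f x * frechet_derivative g (at x) v + frechet_derivative f (at x) v * g x"
  using frechet_derivative_at[OF has_derivative_mult[OF
        assms[unfolded frechet_derivative_works]], THEN fun_cong, of v] by simp

lemma Ck_on_add:
  fixes f g :: "'e::euclidean_space \<Rightarrow> real"
  assumes "open S" "Ck_on k S f" "Ck_on k S g"
  shows "Ck_on k S (\<lambda>x. f x + g x)"
  using assms(2,3)
proof (induction k arbitrary: f g)
  case 0
  then show ?case by (simp add: continuous_on_add)
next
  case (Suc k)
  have "Ck_on k S (\<lambda>x. frechet_derivative (\<lambda>x. f x + g x) (at x) v)" for v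
  proof (rule Ck_on_cong[OF assms(1) _ Suc.IH])
    show "frechet_derivative f (at x) v + frechet_derivative g (at x) v
        = frechet_derivative (\<lambda>x. f x + g x) (at x) v" if "x \<in> S" for x
      using Suc.prems that assms(1)
      by (simp add: frechet_derivative_add differentiable_on_eq_differentiable_at)
  qed (use Suc.prems in auto)
  then show ?case using Suc.prems by (simp add: differentiable_on_add)
qed

lemma Ck_on_mult:
  fixes f g :: "'e::euclidean_space \<Rightarrow> real"
  assumes "open S" "Ck_on k S f" "Ck_on k S g"
  shows "Ck_on k S (\<lambda>x. f x * g x)"
  using assms(2,3)
proof (induction k arbitrary: f g)
  case 0
  then show ?case by (simp add: continuous_on_mult)
next
  case (Suc k)
  have "Ck_on k S (\<lambda>x. frechet_derivative (\<lambda>x. f x * g x) (at x) v)" for v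
  proof (rule Ck_on_cong[OF assms(1) _ Ck_on_add[OF assms(1) Suc.IH Suc.IH]])
    show "f x * frechet_derivative g (at x) v + frechet_derivative f (at x) v * g x
        = frechet_derivative (\<lambda>x. f x * g x) (at x) v" if "x \<in> S" for x
      using Suc.prems that assms(1)
      by (simp add: frechet_derivative_times differentiable_on_eq_differentiable_at)
  qed (use Suc.prems Ck_on_Suc_imp in auto)
  then show ?case using Suc.prems by (simp add: differentiable_on_mult)
qed

lemmas pointwise = plus_fun_apply times_fun_apply zero_fun_apply uminus_apply minus_apply

locale smooth_manifold =
  fixes \<A> :: "('m::{t2_space, second_countable_topology}, 'e::euclidean_space) atlas"
  assumes atlas: "smooth_atlas \<A>"
begin

abbreviation smooth :: "('m \<Rightarrow> real) \<Rightarrow> bool" where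
  "smooth \<equiv> smooth_fun \<A>"

abbreviation VF :: "'m vfield set" where
  "VF \<equiv> vector_fields \<A>"

lemma chart_open: "(U, \<phi>) \<in> \<A> \<Longrightarrow> open (\<phi> ` U)"
  using atlas by (auto simp: smooth_atlas_def)

lemma smooth_const [simp]: "smooth (\<lambda>_. c)"
  by (auto simp: smooth_fun_def smooth_on_def comp_def Ck_on_const)

lemma smooth_zero [simp]: "smooth 0"
  using smooth_const[of 0] by (simp only: zero_fun_def)

lemma smooth_add [simp]: "smooth f \<Longrightarrow> smooth h \<Longrightarrow> smooth (f + h)"
  unfolding smooth_fun_def smooth_on_def comp_def plus_fun_apply
  using Ck_on_add chart_open by fast

lemma smooth_mult [simp]: "smooth f \<Longrightarrow> smooth h \<Longrightarrow> smooth (f * h)"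
  unfolding smooth_fun_def smooth_on_def comp_def times_fun_apply
  using Ck_on_mult chart_open by fast

lemma smooth_uminus [simp]: "smooth f \<Longrightarrow> smooth (- f)"
proof -
  assume "smooth f"
  then have "smooth ((\<lambda>_. -1) * f)" by simp
  also have "(\<lambda>_. -1) * f = - f" by (simp add: fun_eq_iff pointwise)
  finally show ?thesis .
qed

lemma smooth_diff [simp]: "smooth f \<Longrightarrow> smooth h \<Longrightarrow> smooth (f - h)"
  using smooth_add[of f "- h"] by simp

section \<open>The Lie algebra of vector fields\<close>

text \<open>Sums and products of functions are kept as algebraic terms, and a vector field applied to
  such a term is expanded by its derivation laws; evaluation at a point is unfolded only on
  demand.\<close>

declare pointwise [simp del]

lemma
  assumes "X \<in> VF"
  shows vf_add: "smooth f \<Longrightarrow> smooth h \<Longrightarrow> X (f + h) = X f + X h"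
    and vf_scale: "smooth f \<Longrightarrow> X ((\<lambda>_. c) * f) = (\<lambda>_. c) * X f"
    and vf_leibniz: "smooth f \<Longrightarrow> smooth h \<Longrightarrow> X (f * h) = X f * h + f * X h"
    and vf_nonsmooth: "\<not> smooth f \<Longrightarrow> X f = 0"
  using assms by (auto simp: vector_fields_def)

text \<open>A vector field sends a non-smooth function to zero, so its values are always smooth.\<close>

lemma vf_smooth [simp]:
  assumes "X \<in> VF"
  shows "smooth (X f)"
proof (cases "smooth f")
  case True
  then show ?thesis using assms by (auto simp: vector_fields_def)
qed (simp add: vf_nonsmooth[OF assms])

lemma vf_zero_fun: "X \<in> VF \<Longrightarrow> X 0 = 0"
  using vf_add[of X 0 0] by simp

lemma vf_uminus: "X \<in> VF \<Longrightarrow> smooth f \<Longrightarrow> X (- f) = - X f"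
proof -
  assume "X \<in> VF" "smooth f"
  moreover have "(\<lambda>_. -1) * h = - h" for h :: "'m \<Rightarrow> real" by (simp add: fun_eq_iff pointwise)
  ultimately show ?thesis using vf_scale[of X f "-1"] by metis
qed

lemma vf_diff: "X \<in> VF \<Longrightarrow> smooth f \<Longrightarrow> smooth h \<Longrightarrow> X (f - h) = X f - X h"
  using vf_add[of X f "- h"] vf_uminus[of X h] smooth_uminus[of h]
  by (metis add_uminus_conv_diff)

lemma vfield_apply:
  fixes X Y :: "'m vfield"
  shows "(X + Y) f = X f + Y f" "(X - Y) f = X f - Y f" "(- X) f = - X f"
    "(0 :: 'm vfield) f = 0" "(h \<odot> X) f = h * X f"
  by (simp_all add: pointwise fscale_def)

lemma vfield_eq_iff: "X = Y \<longleftrightarrow> (\<forall>f. X f = Y f)" for X Y :: "'m vfield"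
  by (simp add: fun_eq_iff)

lemma add_VF [simp]: "X \<in> VF \<Longrightarrow> Y \<in> VF \<Longrightarrow> X + Y \<in> VF"
  by (simp add: vector_fields_def vfield_apply algebra_simps del: vf_smooth)

lemma fscale_VF [simp]: "smooth h \<Longrightarrow> X \<in> VF \<Longrightarrow> h \<odot> X \<in> VF"
  by (simp add: vector_fields_def vfield_apply algebra_simps del: vf_smooth)

lemma uminus_eq_fscale: "- X = (\<lambda>_. -1) \<odot> X" for X :: "'m vfield"
  by (simp add: fscale_def fun_eq_iff pointwise)

lemma uminus_VF [simp]: "X \<in> VF \<Longrightarrow> - X \<in> VF"
  using fscale_VF[of "\<lambda>_. -1" X] by (simp only: uminus_eq_fscale smooth_const)

lemma diff_VF [simp]: "X \<in> VF \<Longrightarrow> Y \<in> VF \<Longrightarrow> X - Y \<in> VF"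
  using add_VF[of X "- Y"] uminus_VF[of Y] by (simp only: add_uminus_conv_diff)

lemma zero_VF [simp]: "0 \<in> VF"
  by (simp add: vector_fields_def vfield_apply del: vf_smooth)

lemma lie_VF [simp]:
  assumes "X \<in> VF" "Y \<in> VF"
  shows "lie X Y \<in> VF"
proof -
  have "smooth (lie X Y f)" for f
    using assms by (simp add: lie_def)
  moreover have "lie X Y (f + h) = lie X Y f + lie X Y h" if "smooth f" "smooth h" for f h
    using assms that by (simp add: lie_def vf_add)
  moreover have "lie X Y ((\<lambda>_. c) * f) = (\<lambda>_. c) * lie X Y f" if "smooth f" for f c
    using assms that by (simp add: lie_def vf_scale right_diff_distrib)
  moreover have "lie X Y (f * h) = lie X Y f * h + f * lie X Y h"
    if "smooth f" "smooth h" for f h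
    using assms that by (simp add: lie_def vf_leibniz vf_add algebra_simps)
  moreover have "lie X Y f = 0" if "\<not> smooth f" for f
    using assms that by (simp add: lie_def vf_nonsmooth vf_zero_fun)
  ultimately show ?thesis by (simp add: vector_fields_def[of \<A>] del: vf_smooth)
qed

lemma
  assumes "X \<in> VF" "Y \<in> VF" "Z \<in> VF"
  shows lie_add_left: "lie (X + Y) Z = lie X Z + lie Y Z"
    and lie_diff_left: "lie (X - Y) Z = lie X Z - lie Y Z"
  using assms by (simp_all add: vfield_eq_iff vfield_apply lie_def vf_add vf_diff algebra_simps)

lemma
  assumes "X \<in> VF" "Z \<in> VF"
  shows lie_uminus_left: "lie (- X) Z = - lie X Z"
    and lie_uminus_right: "lie Z (- X) = - lie Z X"
  using assms by (simp_all add: vfield_eq_iff vfield_apply lie_def vf_uminus algebra_simps)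

lemma
  assumes "X \<in> VF" "Z \<in> VF"
  shows lie_scale_left: "lie ((\<lambda>_. c) \<odot> X) Z = (\<lambda>_. c) \<odot> lie X Z"
    and lie_scale_right: "lie Z ((\<lambda>_. c) \<odot> X) = (\<lambda>_. c) \<odot> lie Z X"
  using assms by (simp_all add: lie_def fscale_def fun_eq_iff[where 'a="'m \<Rightarrow> real"] vf_scale algebra_simps)

lemma lie_jacobi:
  assumes "X \<in> VF" "Y \<in> VF" "Z \<in> VF"
  shows "lie X (lie Y Z) - lie Y (lie X Z) = lie (lie X Y) Z"
  using assms by (simp add: vfield_eq_iff vfield_apply lie_def vf_diff)

end

section \<open>Hermitian metrics\<close>

locale hermitian = smooth_manifold \<A>
  for \<A> :: "('m::{t2_space, second_countable_topology}, 'e::euclidean_space) atlas" +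
  fixes g :: "'m vfield \<Rightarrow> 'm vfield \<Rightarrow> ('m \<Rightarrow> real)"
    and I :: "'m vfield \<Rightarrow> 'm vfield"
  assumes hermitian: "hermitian_manifold \<A> g I"
begin

lemma
  shows g_smooth [simp]: "X \<in> VF \<Longrightarrow> Y \<in> VF \<Longrightarrow> smooth (g X Y)"
    and g_sym: "X \<in> VF \<Longrightarrow> Y \<in> VF \<Longrightarrow> g X Y = g Y X"
    and g_add_left: "X \<in> VF \<Longrightarrow> Y \<in> VF \<Longrightarrow> Z \<in> VF \<Longrightarrow> g (X + Y) Z = g X Z + g Y Z"
    and g_scale_left: "smooth h \<Longrightarrow> X \<in> VF \<Longrightarrow> Y \<in> VF \<Longrightarrow> g (h \<odot> X) Y = h * g X Y"
    and g_pos: "X \<in> VF \<Longrightarrow> X f p \<noteq> 0 \<Longrightarrow> g X X p > 0"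
    and I_VF [simp]: "X \<in> VF \<Longrightarrow> I X \<in> VF"
    and I_I [simp]: "X \<in> VF \<Longrightarrow> I (I X) = - X"
    and I_add: "X \<in> VF \<Longrightarrow> Y \<in> VF \<Longrightarrow> I (X + Y) = I X + I Y"
    and I_scale: "smooth h \<Longrightarrow> X \<in> VF \<Longrightarrow> I (h \<odot> X) = h \<odot> I X"
    and nijenhuis_zero: "X \<in> VF \<Longrightarrow> Y \<in> VF \<Longrightarrow> nijenhuis I X Y = 0"
    and g_I_I: "X \<in> VF \<Longrightarrow> Y \<in> VF \<Longrightarrow> g (I X) (I Y) = g X Y"
  using hermitian
  unfolding hermitian_manifold_def riemannian_metric_def complex_structure_def
    almost_complex_structure_def by metis+

lemma I_uminus: "X \<in> VF \<Longrightarrow> I (- X) = - I X"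
  using I_scale[of "\<lambda>_. -1" X] by (simp only: uminus_eq_fscale smooth_const)

lemma I_diff: "X \<in> VF \<Longrightarrow> Y \<in> VF \<Longrightarrow> I (X - Y) = I X - I Y"
  using I_add[of X "- Y"] by (simp add: I_uminus)

lemma I_zero [simp]: "I 0 = 0"
  using I_add[of 0 0] by simp

lemmas I_linear = I_add I_diff I_uminus

lemma minus_one_times: "(\<lambda>_. -1) * f = - f" for f :: "'m \<Rightarrow> real"
  by (simp add: fun_eq_iff pointwise)

lemma g_uminus_left: "X \<in> VF \<Longrightarrow> Y \<in> VF \<Longrightarrow> g (- X) Y = - g X Y"
  using g_scale_left[of "\<lambda>_. -1" X Y] by (simp only: uminus_eq_fscale[of X] minus_one_times smooth_const)

lemma g_diff_left: "X \<in> VF \<Longrightarrow> Y \<in> VF \<Longrightarrow> Z \<in> VF \<Longrightarrow> g (X - Y) Z = g X Z - g Y Z"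
  using g_add_left[of X "- Y" Z] by (simp add: g_uminus_left)

lemma g_add_right: "X \<in> VF \<Longrightarrow> Y \<in> VF \<Longrightarrow> Z \<in> VF \<Longrightarrow> g Z (X + Y) = g Z X + g Z Y"
  using g_add_left[of X Y Z] g_sym[of _ Z] by simp

lemma g_uminus_right: "X \<in> VF \<Longrightarrow> Y \<in> VF \<Longrightarrow> g Y (- X) = - g Y X"
  using g_uminus_left[of X Y] g_sym[of _ Y] by simp

lemma g_diff_right: "X \<in> VF \<Longrightarrow> Y \<in> VF \<Longrightarrow> Z \<in> VF \<Longrightarrow> g Z (X - Y) = g Z X - g Z Y"
  using g_diff_left[of X Y Z] g_sym[of _ Z] by simp

lemmas g_linear = g_add_left g_add_right g_diff_left g_diff_right g_uminus_left g_uminus_right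

lemma g_I_left: "X \<in> VF \<Longrightarrow> Y \<in> VF \<Longrightarrow> g (I X) Y = - g X (I Y)"
  using g_I_I[of X "I Y"] by (simp add: g_uminus_right minus_equation_iff[of "g (I X) Y"])

text \<open>Vector fields with equal inner products coincide: the difference has norm zero, so by
  positivity it has value zero on every function at every point.\<close>

lemma vfield_eqI:
  assumes "X \<in> VF" "Y \<in> VF" and eq: "\<And>U. U \<in> VF \<Longrightarrow> g X U = g Y U"
  shows "X = Y"
proof -
  have "g (X - Y) (X - Y) = 0"
    using assms by (simp add: g_diff_left)
  then have "(X - Y) f p = 0" for f p
    using g_pos[of "X - Y" f p] assms(1,2) by (auto simp: pointwise)
  then show ?thesis by (simp add: fun_eq_iff pointwise)
qed

text \<open>The vanishing of the Nijenhuis tensor, solved for the bracket of rotated fields.\<close>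

lemma lie_I_I:
  assumes "v \<in> VF" "w \<in> VF"
  shows "lie (I v) (I w) = lie v w + I (lie (I v) w + lie v (I w))"
  using nijenhuis_zero[OF assms] assms by (simp add: nijenhuis_def I_add algebra_simps)

text \<open>For \<open>V = v + \<i> I v\<close> and \<open>W = w + \<i> I w\<close> the left-hand side is the imaginary part of \<open>[V, W]\<close>
  and the argument of \<open>I\<close> on the right is its real part: brackets of (0,1) fields are again of
  type (0,1).\<close>

lemma lie_mixed:
  assumes "v \<in> VF" "w \<in> VF"
  shows "lie (I v) w + lie v (I w) = I (lie v w - lie (I v) (I w))"
  using assms by (simp add: lie_I_I I_linear)

end

section \<open>The Chern connection\<close>

locale chern = hermitian \<A> g I
  for \<A> :: "('m::{t2_space, second_countable_topology}, 'e::euclidean_space) atlas"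
    and g I +
  fixes D :: "'m vfield \<Rightarrow> 'm vfield \<Rightarrow> 'm vfield"
  assumes chern: "chern_connection \<A> g I D"
begin

lemma metric_conn: "metric_connection \<A> g D"
  using chern by (simp add: chern_connection_def)

lemma conn: "connection \<A> D"
  using metric_conn by (simp add: metric_connection_def)

lemma
  shows D_VF [simp]: "X \<in> VF \<Longrightarrow> Y \<in> VF \<Longrightarrow> D X Y \<in> VF"
    and D_add_left: "X \<in> VF \<Longrightarrow> Y \<in> VF \<Longrightarrow> Z \<in> VF \<Longrightarrow> D (X + Y) Z = D X Z + D Y Z"
    and D_add_right: "X \<in> VF \<Longrightarrow> Y \<in> VF \<Longrightarrow> Z \<in> VF \<Longrightarrow> D Z (X + Y) = D Z X + D Z Y"
    and D_scale_left: "smooth h \<Longrightarrow> X \<in> VF \<Longrightarrow> Y \<in> VF \<Longrightarrow> D (h \<odot> X) Y = h \<odot> D X Y"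
    and D_leibniz: "smooth h \<Longrightarrow> X \<in> VF \<Longrightarrow> Y \<in> VF \<Longrightarrow> D X (h \<odot> Y) = X h \<odot> Y + h \<odot> D X Y"
  using conn unfolding connection_def by metis+

lemma vf_const_fun: "X \<in> VF \<Longrightarrow> X (\<lambda>_. c) = 0"
proof -
  assume X: "X \<in> VF"
  have 1: "X 1 = 0"
    using vf_leibniz[OF X, of 1 1] smooth_const[of 1] by (simp add: one_fun_def[symmetric])
  have "X ((\<lambda>_. c) * 1) = (\<lambda>_. c) * X 1"
    using smooth_const[of 1] by (intro vf_scale[OF X]) (simp add: one_fun_def)
  then show ?thesis by (simp add: 1)
qed

lemma D_scale_right: "X \<in> VF \<Longrightarrow> Y \<in> VF \<Longrightarrow> D X ((\<lambda>_. c) \<odot> Y) = (\<lambda>_. c) \<odot> D X Y"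
  by (simp add: D_leibniz vf_const_fun vfield_eq_iff vfield_apply)

lemma D_uminus_left: "X \<in> VF \<Longrightarrow> Y \<in> VF \<Longrightarrow> D (- X) Y = - D X Y"
  using D_scale_left[of "\<lambda>_. -1" X Y] by (simp only: uminus_eq_fscale smooth_const)

lemma D_uminus_right: "X \<in> VF \<Longrightarrow> Y \<in> VF \<Longrightarrow> D Y (- X) = - D Y X"
  using D_scale_right[of Y X "-1"] by (simp only: uminus_eq_fscale)

lemma D_diff_left: "X \<in> VF \<Longrightarrow> Y \<in> VF \<Longrightarrow> Z \<in> VF \<Longrightarrow> D (X - Y) Z = D X Z - D Y Z"
  using D_add_left[of X "- Y" Z] by (simp add: D_uminus_left)

lemma D_diff_right: "X \<in> VF \<Longrightarrow> Y \<in> VF \<Longrightarrow> Z \<in> VF \<Longrightarrow> D Z (X - Y) = D Z X - D Z Y"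
  using D_add_right[of X "- Y" Z] by (simp add: D_uminus_right)

lemmas D_linear = D_add_left D_add_right D_diff_left D_diff_right D_uminus_left D_uminus_right

lemma D_metric:
  "X \<in> VF \<Longrightarrow> Y \<in> VF \<Longrightarrow> Z \<in> VF \<Longrightarrow> X (g Y Z) = g (D X Y) Z + g Y (D X Z)"
  using metric_conn by (simp add: metric_connection_def)

lemma D_I: "X \<in> VF \<Longrightarrow> Y \<in> VF \<Longrightarrow> D X (I Y) = I (D X Y)"
  using chern by (simp add: chern_connection_def)

lemma half_double: "(\<lambda>_. 1/2) \<odot> (X + X) = X" for X :: "'m vfield"
  by (simp add: fscale_def fun_eq_iff pointwise)

text \<open>Over the reals, the operator $D_V$ with \<open>V = v + \<i> I v\<close> on the bundle \<open>TM\<close>, complex via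
  \<open>I\<close>, is the left-hand side. The defining property of the Chern connection is evaluated
  at \<open>V\<close> and \<open>W = w - \<i> I w\<close>, and only the real part is compared; the projection of the bracket to
  type (1,0) is simplified by the vanishing of the Nijenhuis tensor.\<close>

lemma D_01_eq_lie:
  assumes v: "v \<in> VF" and w: "w \<in> VF"
  shows "D v w + I (D (I v) w) = lie v w + I (lie (I v) w)"
proof -
  have "(v, I v) \<in> T01 \<A> I" and "(w, - I w) \<in> T10 \<A> I"
    using assms by (auto simp: T01_def T10_def cv_i_def I_uminus)
  then have "cv_bilinear D (v, I v) (w, - I w) = dbar_T10 I (v, I v) (w, - I w)"
    using chern by (simp add: chern_connection_def)
  then have "D v w + I (D (I v) w) =
      (\<lambda>_. 1/2) \<odot> (lie v w + lie (I v) (I w) + I (lie (I v) w - lie v (I w)))"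
    using assms
    by (simp add: cv_bilinear_def dbar_T10_def proj10_def cv_half_def cv_i_def D_uminus_right
        lie_uminus_right D_I I_add I_uminus)
  also have "lie v w + lie (I v) (I w) + I (lie (I v) w - lie v (I w))
      = (lie v w + I (lie (I v) w)) + (lie v w + I (lie (I v) w))"
    using assms by (simp add: lie_I_I I_linear)
  finally show ?thesis by (simp only: half_double)
qed

lemma curvature_VF [simp]:
  "v \<in> VF \<Longrightarrow> w \<in> VF \<Longrightarrow> z \<in> VF \<Longrightarrow> curvature D v w z \<in> VF"
  by (simp add: curvature_def)

lemma curvature_I: "v \<in> VF \<Longrightarrow> w \<in> VF \<Longrightarrow> z \<in> VF \<Longrightarrow>
    curvature D v w (I z) = I (curvature D v w z)"
  by (simp add: curvature_def D_I I_diff)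

text \<open>Differentiate \<open>g z u\<close> twice with the metric property and antisymmetrise; the mixed
  first-order terms cancel.\<close>

lemma curvature_skew:
  assumes "v \<in> VF" "w \<in> VF" "z \<in> VF" "u \<in> VF"
  shows "g (curvature D v w z) u = - g z (curvature D v w u)"
proof -
  have "lie v w (g z u) = v (w (g z u)) - w (v (g z u))"
    by (simp add: lie_def)
  then have "g (D (lie v w) z) u + g z (D (lie v w) u) =
      v (g (D w z) u + g z (D w u)) - w (g (D v z) u + g z (D v u))"
    using assms by (simp add: D_metric)
  then show ?thesis
    using assms by (simp add: curvature_def g_linear vf_add D_metric algebra_simps)
qed

text \<open>The (0,2) part of the curvature on the complex bundle \<open>TM\<close>. With \<open>del x\<close> the (0,1) part of
  \<open>D\<close>, it is the commutator of \<open>del v\<close> and \<open>del w\<close> minus \<open>del c\<close>, where \<open>c\<close> is the real part of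
  the bracket of the two (0,1) fields. As \<open>del\<close> is given by Lie brackets, the Jacobi identity
  makes this vanish.\<close>

lemma curvature_02_part:
  assumes "v \<in> VF" "w \<in> VF" "z \<in> VF"
  shows "curvature D v w z - curvature D (I v) (I w) z
    = - I (curvature D (I v) w z + curvature D v (I w) z)"
proof -
  define del where "del x y = D x y + I (D (I x) y)" for x y
  have del_lie: "del x y = lie x y + I (lie (I x) y)" if "x \<in> VF" "y \<in> VF" for x y
    using that by (simp add: del_def D_01_eq_lie)
  have del_VF [simp]: "del x y \<in> VF" if "x \<in> VF" "y \<in> VF" for x y
    using that by (simp add: del_def)
  have del_I: "del x (I y) = I (del x y)" if "x \<in> VF" "y \<in> VF" for x y
    using that by (simp add: del_def D_I I_linear)
  have del_add: "del x (y + y') = del x y + del x y'" if "x \<in> VF" "y \<in> VF" "y' \<in> VF" for x y y'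
    using that by (simp add: del_def D_linear I_linear)
  define c where "c = lie v w - lie (I v) (I w)"
  have Ic: "I c = lie (I v) w + lie v (I w)"
    using assms by (simp add: c_def lie_mixed)
  have iter: "del x (del y z) = (lie x (lie y z) - lie (I x) (lie (I y) z))
      + I (lie (I x) (lie y z) + lie x (lie (I y) z))" if "x \<in> VF" "y \<in> VF" for x y
  proof -
    have "del x (del y z) = del x (lie y z) + I (del x (lie (I y) z))"
      using that assms(3) by (simp add: del_lie[of y z] del_add del_I)
    then show ?thesis using that assms(3) by (simp add: del_lie I_linear algebra_simps)
  qed
  have "del v (del w z) - del w (del v z) =
      (lie v (lie w z) - lie w (lie v z)) - (lie (I v) (lie (I w) z) - lie (I w) (lie (I v) z))
      + I ((lie (I v) (lie w z) - lie w (lie (I v) z)) + (lie v (lie (I w) z) - lie (I w) (lie v z)))"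
    using assms by (simp add: iter I_linear)
  also have "\<dots> = lie c z + I (lie (I c) z)"
    using assms unfolding Ic unfolding c_def by (simp add: lie_jacobi lie_add_left lie_diff_left)
  also have "\<dots> = del c z"
    using assms by (simp add: del_lie c_def)
  also have "\<dots> = D (lie v w) z - D (lie (I v) (I w)) z
      + I (D (lie (I v) w) z + D (lie v (I w)) z)"
    unfolding del_def Ic using assms by (simp add: c_def D_linear)
  finally show ?thesis
    using assms by (simp add: del_def curvature_def I_linear D_linear D_I algebra_simps)
qed

text \<open>The (0,2) part only relates two endomorphisms, \<open>P = - I Q\<close>. Both are skew and \<open>Q\<close> commutes
  with \<open>I\<close>, so \<open>- I Q\<close> is symmetric. A skew symmetric \<open>P\<close> is zero.\<close>

theorem chern_curvature_11:
  assumes "v \<in> VF" "w \<in> VF" "z \<in> VF"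
  shows "curvature D (I v) (I w) z = curvature D v w z"
proof (rule vfield_eqI)
  fix u assume u: "u \<in> VF"
  define P where "P x = curvature D v w x - curvature D (I v) (I w) x" for x
  define Q where "Q x = curvature D (I v) w x + curvature D v (I w) x" for x
  have VF [simp]: "P x \<in> VF" "Q x \<in> VF" if "x \<in> VF" for x
    using that assms by (simp_all add: P_def Q_def)
  have PQ: "P x = - I (Q x)" if "x \<in> VF" for x
    using curvature_02_part[OF assms(1,2) that] by (simp add: P_def Q_def)
  have P_skew: "g (P x) y = - g x (P y)" if "x \<in> VF" "y \<in> VF" for x y
    using that assms by (simp add: P_def g_linear curvature_skew)
  have Q_skew: "g (Q x) y = - g x (Q y)" if "x \<in> VF" "y \<in> VF" for x y
    using that assms by (simp add: Q_def g_linear curvature_skew)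
  have Q_I: "Q (I x) = I (Q x)" if "x \<in> VF" for x
    using that assms by (simp add: Q_def curvature_I I_add)
  have "g (P z) u = g z (P u)"
    using assms u by (simp add: PQ g_uminus_left g_uminus_right g_I_left Q_skew Q_I)
  with P_skew[OF assms(3) u] have "g (P z) u = - g (P z) u"
    by (simp only:)
  then have "g (P z) u = 0"
    by (simp add: fun_eq_iff pointwise)
  then show "g (curvature D (I v) (I w) z) u = g (curvature D v w z) u"
    using assms u by (simp add: P_def g_diff_left)
qed (use assms in simp_all)

end

section \<open>Three-forms of type (2,1) + (1,2)\<close>

locale three_form = hermitian \<A> g I
  for \<A> :: "('m::{t2_space, second_countable_topology}, 'e::euclidean_space) atlas"
    and g I +
  fixes F :: "'m vfield \<Rightarrow> 'm vfield \<Rightarrow> 'm vfield \<Rightarrow> ('m \<Rightarrow> real)"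
  assumes F_smooth [simp]: "x \<in> VF \<Longrightarrow> y \<in> VF \<Longrightarrow> z \<in> VF \<Longrightarrow> smooth (F x y z)"
    and F_add1: "x \<in> VF \<Longrightarrow> x' \<in> VF \<Longrightarrow> y \<in> VF \<Longrightarrow> z \<in> VF \<Longrightarrow>
      F (x + x') y z = F x y z + F x' y z"
    and F_scale1: "smooth h \<Longrightarrow> x \<in> VF \<Longrightarrow> y \<in> VF \<Longrightarrow> z \<in> VF \<Longrightarrow>
      F (h \<odot> x) y z = h * F x y z"
    and F_swap12: "x \<in> VF \<Longrightarrow> y \<in> VF \<Longrightarrow> z \<in> VF \<Longrightarrow> F x y z = - F y x z"
    and F_swap23: "x \<in> VF \<Longrightarrow> y \<in> VF \<Longrightarrow> z \<in> VF \<Longrightarrow> F x y z = - F x z y"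
begin

lemma F_scale2: "smooth h \<Longrightarrow> x \<in> VF \<Longrightarrow> y \<in> VF \<Longrightarrow> z \<in> VF \<Longrightarrow> F x (h \<odot> y) z = h * F x y z"
  using F_swap12[of x _ z] by (simp add: F_scale1)

lemma F_scale3: "smooth h \<Longrightarrow> x \<in> VF \<Longrightarrow> y \<in> VF \<Longrightarrow> z \<in> VF \<Longrightarrow> F x y (h \<odot> z) = h * F x y z"
  using F_swap23[of x y _] by (simp add: F_scale2)

lemma F_add2: "x \<in> VF \<Longrightarrow> y \<in> VF \<Longrightarrow> y' \<in> VF \<Longrightarrow> z \<in> VF \<Longrightarrow>
    F x (y + y') z = F x y z + F x y' z"
  using F_swap12[of x _ z] by (simp add: F_add1)

lemma F_add3: "x \<in> VF \<Longrightarrow> y \<in> VF \<Longrightarrow> z \<in> VF \<Longrightarrow> z' \<in> VF \<Longrightarrow>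
    F x y (z + z') = F x y z + F x y z'"
  using F_swap23[of x y _] by (simp add: F_add2)

lemma
  assumes "x \<in> VF" "y \<in> VF" "z \<in> VF"
  shows F_uminus1: "F (- x) y z = - F x y z"
    and F_uminus2: "F x (- y) z = - F x y z"
    and F_uminus3: "F x y (- z) = - F x y z"
  unfolding uminus_eq_fscale using assms
  by (simp_all only: F_scale1 F_scale2 F_scale3 smooth_const minus_one_times)

lemma F_diff1: "x \<in> VF \<Longrightarrow> x' \<in> VF \<Longrightarrow> y \<in> VF \<Longrightarrow> z \<in> VF \<Longrightarrow>
    F (x - x') y z = F x y z - F x' y z"
  using F_add1[of x "- x'" y z] by (simp add: F_uminus1)

lemma F_diff3: "x \<in> VF \<Longrightarrow> y \<in> VF \<Longrightarrow> z \<in> VF \<Longrightarrow> z' \<in> VF \<Longrightarrow>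
    F x y (z - z') = F x y z - F x y z'"
  using F_add3[of x y z "- z'"] by (simp add: F_uminus3)

lemma F_diff2: "x \<in> VF \<Longrightarrow> y \<in> VF \<Longrightarrow> y' \<in> VF \<Longrightarrow> z \<in> VF \<Longrightarrow>
    F x (y - y') z = F x y z - F x y' z"
  using F_add2[of x y "- y'" z] by (simp add: F_uminus2)

lemmas F_linear = F_add1 F_add2 F_add3 F_diff1 F_diff2 F_diff3 F_uminus1 F_uminus2 F_uminus3

text \<open>The exterior derivative of \<open>F\<close>, as a function of four vector fields.\<close>

definition dF :: "'m vfield \<Rightarrow> 'm vfield \<Rightarrow> 'm vfield \<Rightarrow> 'm vfield \<Rightarrow> ('m \<Rightarrow> real)" where
  "dF v w z u =
     v (F w z u) - w (F v z u) + z (F v w u) - u (F v w z)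
     - F (lie v w) z u + F (lie v z) w u - F (lie v u) w z
     - F (lie w z) v u + F (lie w u) v z - F (lie z u) v w"

lemma
  assumes "v \<in> VF" "w \<in> VF" "z \<in> VF" "u \<in> VF"
  shows dF_scale1: "dF ((\<lambda>_. c) \<odot> v) w z u = (\<lambda>_. c) * dF v w z u"
    and dF_scale2: "dF v ((\<lambda>_. c) \<odot> w) z u = (\<lambda>_. c) * dF v w z u"
    and dF_scale3: "dF v w ((\<lambda>_. c) \<odot> z) u = (\<lambda>_. c) * dF v w z u"
    and dF_scale4: "dF v w z ((\<lambda>_. c) \<odot> u) = (\<lambda>_. c) * dF v w z u"
  using assms
  by (simp_all add: dF_def F_scale1 F_scale2 F_scale3 lie_scale_left lie_scale_right vf_scale
      vfield_apply algebra_simps)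

lemma
  assumes "v \<in> VF" "w \<in> VF" "z \<in> VF" "u \<in> VF"
  shows dF_uminus1: "dF (- v) w z u = - dF v w z u"
    and dF_uminus2: "dF v (- w) z u = - dF v w z u"
    and dF_uminus3: "dF v w (- z) u = - dF v w z u"
    and dF_uminus4: "dF v w z (- u) = - dF v w z u"
  unfolding uminus_eq_fscale using assms
  by (simp_all only: dF_scale1 dF_scale2 dF_scale3 dF_scale4 minus_one_times)

lemmas dF_uminus = dF_uminus1 dF_uminus2 dF_uminus3 dF_uminus4

text \<open>Let $J_k$ denote the insertion of \<open>I\<close> in slot \<open>k\<close>. The projection of a four-form to type (2,2)
  is $\frac18 (3 + \sum_{j<k} J_j J_k + 3 J_0 J_1 J_2 J_3)$: on a product of vectors of pure type $J_k$ is
  multiplication by \<open>\<i>\<close> or \<open>- \<i>\<close>, and the bracket takes the value 8 if two of the four types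
  are (1,0) and 0 otherwise.\<close>

definition dF_no_22_part :: bool where
  "dF_no_22_part \<longleftrightarrow> (\<forall>v\<in>VF. \<forall>w\<in>VF. \<forall>z\<in>VF. \<forall>u\<in>VF. \<forall>p.
     3 * dF v w z u p + dF (I v) (I w) z u p + dF (I v) w (I z) u p + dF (I v) w z (I u) p
     + dF v (I w) (I z) u p + dF v (I w) z (I u) p + dF v w (I z) (I u) p
     + 3 * dF (I v) (I w) (I z) (I u) p = 0)"

text \<open>The real part of $(1 + i J_0)(1 + i J_1)(1 - i J_2)(1 - i J_3)$ applied to \<open>dF\<close>, that
  is, of \<open>dF\<close> at two vectors of type (0,1) followed by two of type (1,0). This operator absorbs
  the projection to type (2,2), so it is obtained by applying its own eight terms
  to the (2,2) condition: the claim is one eighth of the signed sum of the eight instances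
  below.\<close>

lemma dF_no_22_partD:
  assumes "dF_no_22_part" and VF: "v \<in> VF" "w \<in> VF" "z \<in> VF" "u \<in> VF"
  shows "dF v w z u - dF (I v) (I w) z u - dF v w (I z) (I u)
    + dF (I v) w (I z) u + dF (I v) w z (I u) + dF v (I w) (I z) u + dF v (I w) z (I u)
    + dF (I v) (I w) (I z) (I u) = 0"
proof
  fix p
  note * = assms(1)[unfolded dF_no_22_part_def, rule_format, where p = p]
  show "(dF v w z u - dF (I v) (I w) z u - dF v w (I z) (I u)
    + dF (I v) w (I z) u + dF (I v) w z (I u) + dF v (I w) (I z) u + dF v (I w) z (I u)
    + dF (I v) (I w) (I z) (I u)) p = 0 p"
    using VF *[of v w z u] *[of "I v" "I w" z u] *[of v w "I z" "I u"] *[of "I v" w "I z" u]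
      *[of "I v" w z "I u"] *[of v "I w" "I z" u] *[of v "I w" z "I u"]
      *[of "I v" "I w" "I z" "I u"]
    by (simp add: dF_uminus pointwise)
qed

end

locale form_21_12 = three_form \<A> g I F
  for \<A> :: "('m::{t2_space, second_countable_topology}, 'e::euclidean_space) atlas"
    and g I F +
  assumes F_type: "x \<in> VF \<Longrightarrow> y \<in> VF \<Longrightarrow> z \<in> VF \<Longrightarrow>
    F x y z = F (I x) (I y) z + F (I x) y (I z) + F x (I y) (I z)"
begin

text \<open>The form \<open>F\<close> is real of type (2,1) + (1,2), so \<open>F = 2 Re \<theta>\<close> for its (2,1) part \<open>\<theta>\<close>. On type
  (2,1) the insertion of \<open>I\<close> in all slots is multiplication by \<open>\<i>\<close>, which gives
  \<open>\<theta> = (F - \<i> K) / 2\<close>.\<close>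

definition K :: "'m vfield \<Rightarrow> 'm vfield \<Rightarrow> 'm vfield \<Rightarrow> ('m \<Rightarrow> real)" where
  "K x y z = F (I x) (I y) (I z)"

sublocale K: three_form \<A> g I K
proof
  fix x y z assume "x \<in> VF" "y \<in> VF" "z \<in> VF"
  then show "K x y z = - K y x z" "K x y z = - K x z y"
    using F_swap12[of "I x" "I y" "I z"] F_swap23[of "I x" "I y" "I z"] by (simp_all add: K_def)
qed (simp_all add: K_def I_add I_scale F_linear F_scale1)

abbreviation "dK \<equiv> K.dF"

text \<open>Up to a constant, the real part of the (2,1) part of \<open>F\<close> at the vectors
  \<open>v + \<i> I v\<close>, \<open>z - \<i> I z\<close>, \<open>u - \<i> I u\<close>. Hence it is skew in the last two slots, and the
  insertion of \<open>I\<close> can be moved between slots (\<open>h_I1\<close>, \<open>h_I3\<close>).\<close>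

definition h :: "'m vfield \<Rightarrow> 'm vfield \<Rightarrow> 'm vfield \<Rightarrow> ('m \<Rightarrow> real)" where
  "h v z u = F v z u - F v (I z) (I u)"

lemma h_smooth [simp]: "v \<in> VF \<Longrightarrow> z \<in> VF \<Longrightarrow> u \<in> VF \<Longrightarrow> smooth (h v z u)"
  by (simp add: h_def)

lemma h_swap: "v \<in> VF \<Longrightarrow> z \<in> VF \<Longrightarrow> u \<in> VF \<Longrightarrow> h v z u = - h v u z"
  using F_swap23[of v z u] F_swap23[of v "I z" "I u"] by (simp add: h_def)

lemma h_I3: "v \<in> VF \<Longrightarrow> z \<in> VF \<Longrightarrow> u \<in> VF \<Longrightarrow> h v z (I u) = h v (I z) u"
  by (simp add: h_def F_linear)

lemma h_I1: "v \<in> VF \<Longrightarrow> z \<in> VF \<Longrightarrow> u \<in> VF \<Longrightarrow> h (I v) z u = - h v (I z) u"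
  using F_type[of "I v" z u] by (simp add: h_def F_linear algebra_simps)

lemma h_add1: "v \<in> VF \<Longrightarrow> v' \<in> VF \<Longrightarrow> z \<in> VF \<Longrightarrow> u \<in> VF \<Longrightarrow> h (v + v') z u = h v z u + h v' z u"
  by (simp add: h_def F_linear)

lemma h_diff1: "v \<in> VF \<Longrightarrow> v' \<in> VF \<Longrightarrow> z \<in> VF \<Longrightarrow> u \<in> VF \<Longrightarrow> h (v - v') z u = h v z u - h v' z u"
  by (simp add: h_def F_linear)

lemma h_add2: "v \<in> VF \<Longrightarrow> z \<in> VF \<Longrightarrow> z' \<in> VF \<Longrightarrow> u \<in> VF \<Longrightarrow> h v (z + z') u = h v z u + h v z' u"
  by (simp add: h_def I_add F_linear)

lemma h_add3: "v \<in> VF \<Longrightarrow> z \<in> VF \<Longrightarrow> u \<in> VF \<Longrightarrow> u' \<in> VF \<Longrightarrow> h v z (u + u') = h v z u + h v z u'"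
  by (simp add: h_def I_add F_linear)

lemma
  assumes "v \<in> VF" "z \<in> VF" "u \<in> VF"
  shows h_uminus1: "h (- v) z u = - h v z u"
    and h_uminus2: "h v (- z) u = - h v z u"
    and h_uminus3: "h v z (- u) = - h v z u"
  using assms by (simp_all add: h_def I_uminus F_linear)

lemmas h_linear = h_add1 h_diff1 h_add2 h_add3 h_uminus1 h_uminus2 h_uminus3

text \<open>The Dolbeault operator of $T^{1,0}$ along \<open>v + \<i> I v\<close>, read on the complex bundle \<open>TM\<close>. It is
  antilinear in \<open>v\<close> and commutes with \<open>I\<close> by the vanishing of the Nijenhuis tensor.\<close>

definition lie01 :: "'m vfield \<Rightarrow> 'm vfield \<Rightarrow> 'm vfield" where
  "lie01 v z = lie v z + I (lie (I v) z)"

lemma lie01_VF [simp]: "v \<in> VF \<Longrightarrow> z \<in> VF \<Longrightarrow> lie01 v z \<in> VF"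
  by (simp add: lie01_def)

lemma lie01_I1: "v \<in> VF \<Longrightarrow> z \<in> VF \<Longrightarrow> lie01 (I v) z = - I (lie01 v z)"
  by (simp add: lie01_def lie_uminus_left I_linear)

lemma lie01_I2: "v \<in> VF \<Longrightarrow> z \<in> VF \<Longrightarrow> lie01 v (I z) = I (lie01 v z)"
  using lie_I_I[of v z] by (simp add: lie01_def I_linear algebra_simps)

text \<open>The real form of $\overline\partial H^{2,1}$ at \<open>v + \<i> I v\<close>, \<open>w + \<i> I w\<close> and the (1,0) vectors of \<open>z\<close>
  and \<open>u\<close>: the exterior covariant derivative of \<open>h\<close>, viewed as a (0,1) form with values in the
  skew forms on $T^{1,0}$. The last term has the real part of the bracket of the two (0,1)
  fields.\<close>

definition dbar_h :: "'m vfield \<Rightarrow> 'm vfield \<Rightarrow> 'm vfield \<Rightarrow> 'm vfield \<Rightarrow> ('m \<Rightarrow> real)" where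
  "dbar_h v w z u =
     v (h w z u) + I v (h w (I z) u) - h w (lie01 v z) u - h w z (lie01 v u)
     - (w (h v z u) + I w (h v (I z) u) - h v (lie01 w z) u - h v z (lie01 w u))
     - h (lie v w - lie (I v) (I w)) z u"

text \<open>\<open>dbar_h\<close> is the real part of an expression that is complex linear in \<open>z\<close> and \<open>u\<close> and complex
  antilinear in \<open>v\<close>. This and the next two lemmas are the instances of that symmetry by which
  four values of \<open>dbar_h\<close> add up to a multiple of one.\<close>

lemma dbar_h_I34:
  assumes "v \<in> VF" "w \<in> VF" "z \<in> VF" "u \<in> VF"
  shows "dbar_h v w (I z) (I u) = - dbar_h v w z u"
  using assms
  by (simp add: dbar_h_def I_uminus h_I3 h_linear lie01_I2 vf_uminus algebra_simps)

lemma dbar_h_I13: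
  assumes "v \<in> VF" "w \<in> VF" "z \<in> VF" "u \<in> VF"
  shows "dbar_h (I v) w (I z) u = dbar_h v w z u"
proof -
  have "lie (I v) w - lie (I (I v)) (I w) = I (lie v w - lie (I v) (I w))"
    using assms by (simp add: lie_mixed[symmetric] lie_uminus_left)
  then show ?thesis using assms unfolding dbar_h_def
    by (simp add: I_uminus h_I3 h_I1 h_linear lie01_I2 lie01_I1 vf_uminus vfield_apply algebra_simps)
qed

lemma dbar_h_I14:
  assumes "v \<in> VF" "w \<in> VF" "z \<in> VF" "u \<in> VF"
  shows "dbar_h (I v) w z (I u) = dbar_h v w z u"
proof -
  have "lie (I v) w - lie (I (I v)) (I w) = I (lie v w - lie (I v) (I w))"
    using assms by (simp add: lie_mixed[symmetric] lie_uminus_left)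
  then show ?thesis using assms unfolding dbar_h_def
    by (simp add: I_uminus h_I3 h_I1 h_linear lie01_I2 lie01_I1 vf_uminus vfield_apply algebra_simps)
qed

text \<open>The left-hand side is a multiple of the real part of the (2,1) part at \<open>x\<close>, \<open>v + \<i> I v\<close>,
  \<open>w + \<i> I w\<close>, which vanishes since a (2,1) form has no room for two vectors of type (0,1).\<close>

lemma F_K_vanish:
  assumes "x \<in> VF" "v \<in> VF" "w \<in> VF"
  shows "F x v w - F x (I v) (I w) + K x (I v) w + K x v (I w) = 0"
  using assms F_type[of x v w] by (simp add: K_def F_linear)

lemma F_K_vanish':
  assumes "x \<in> VF" "v \<in> VF" "w \<in> VF"
  shows "F v w x - F (I v) (I w) x + K (I v) w x + K v (I w) x = 0"
  using assms F_type[of v w x] by (simp add: K_def F_linear)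

text \<open>The terms of \<open>dF_dK_eq_dbar_h\<close> with the bracket of \<open>v\<close> and one of the last two arguments: if
  \<open>x\<close> and \<open>y\<close> are the brackets of \<open>v\<close> and \<open>I v\<close> with that argument, they enter only through
  its (0,1) derivative \<open>x + I y\<close>. The brackets with \<open>w\<close> are treated by exchanging \<open>v\<close> and \<open>w\<close>.\<close>

lemma F_K_bracket:
  assumes "x \<in> VF" "y \<in> VF" "w \<in> VF" "u \<in> VF"
  shows "F x w u + K x (I w) u - F y (I w) u + K y w u = - h w (x + I y) u"
  using assms F_type[of y "I w" u] 
    F_swap12[of x w u] F_swap12[of "I x" w "I u"] F_swap12[of "I y" w u] F_swap12[of y w "I u"]
  by (simp add: K_def h_def F_linear I_linear algebra_simps)

text \<open>The terms of \<open>dF_dK_eq_dbar_h\<close> that are differentiated along \<open>v\<close> and \<open>I v\<close>, or, with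
  \<open>v\<close> and \<open>w\<close> exchanged, along \<open>w\<close> and \<open>I w\<close>.\<close>

lemma F_K_derivative:
  assumes "v \<in> VF" "w \<in> VF" "z \<in> VF" "u \<in> VF"
  shows "v (F w z u) + v (K (I w) z u) = v (h w z u)"
    and "I v (K w z u) - I v (F (I w) z u) = I v (h w (I z) u)"
proof -
  have "F w z u + K (I w) z u = h w z u"
    using assms by (simp add: K_def h_def F_linear)
  then show "v (F w z u) + v (K (I w) z u) = v (h w z u)"
    using assms by (simp flip: vf_add)
  have "K w z u - F (I w) z u = h w (I z) u"
    using assms F_type[of "I w" z u] by (simp add: K_def h_def F_linear)
  then show "I v (K w z u) - I v (F (I w) z u) = I v (h w (I z) u)"
    using assms by (simp flip: vf_diff)
qed

text \<open>The terms of \<open>dF_dK_eq_dbar_h\<close> that are differentiated along one of the last two arguments.\<close>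

lemma F_K_derivative_zero:
  assumes "v \<in> VF" "w \<in> VF" "z \<in> VF" "u \<in> VF"
  shows "z (F v w u) - z (F (I v) (I w) u) + z (K (I v) w u) + z (K v (I w) u) = 0"
proof -
  have "z (F v w u - F (I v) (I w) u + K (I v) w u + K v (I w) u) = 0"
    using assms by (simp add: F_K_vanish' vf_zero_fun)
  then show ?thesis using assms by (simp add: vf_add vf_diff)
qed

text \<open>The left-hand side is the real part of the exterior derivative of \<open>F - \<i> K\<close>, twice the
  (2,1) part, at \<open>v + \<i> I v\<close>, \<open>w + \<i> I w\<close>, \<open>z\<close>, \<open>u\<close>. Two arguments of type (0,1) suffice to kill
  the derivatives along \<open>z\<close> and \<open>u\<close> and the bracket of \<open>z\<close> and \<open>u\<close>, and what remains is the
  covariant expression \<open>dbar_h\<close>. The ten groups of terms are matched one by one.\<close>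

lemma dF_dK_eq_dbar_h:
  assumes VF: "v \<in> VF" "w \<in> VF" "z \<in> VF" "u \<in> VF"
  shows "dF v w z u - dF (I v) (I w) z u + dK (I v) w z u + dK v (I w) z u = dbar_h v w z u"
proof -
  define c where "c = lie v w - lie (I v) (I w)"
  have [simp]: "c \<in> VF" using VF by (simp add: c_def)
  have "F c z u + K (I c) z u = h c z u"
    using VF by (simp add: K_def h_def F_linear)
  then have vw: "F (lie v w) z u - F (lie (I v) (I w)) z u
      + (K (lie (I v) w) z u + K (lie v (I w)) z u) = h c z u"
    using VF by (simp add: lie_mixed[symmetric] c_def K.F_add1 F_diff1)
  have br: "F (lie x y) s t + K (lie x y) (I s) t - F (lie (I x) y) (I s) t + K (lie (I x) y) s t
      = - h s (lie01 x y) t" if "x \<in> VF" "y \<in> VF" "s \<in> VF" "t \<in> VF" for x y s t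
    using that by (simp add: F_K_bracket lie01_def)
  note terms = F_K_derivative[OF VF] F_K_derivative[OF VF(2,1,3,4)] F_K_derivative_zero[OF VF]
    F_K_derivative_zero[OF VF(1,2,4,3)] vw br[OF VF(1,3,2,4)] br[OF VF(1,4,2,3)]
    br[OF VF(2,3,1,4)] br[OF VF(2,4,1,3)] F_K_vanish[OF lie_VF[OF VF(3,4)] VF(1,2)]
    h_swap[OF VF(2) lie01_VF[OF VF(1,4)] VF(3)] h_swap[OF VF(1) lie01_VF[OF VF(2,4)] VF(3)]
  show ?thesis
    unfolding dbar_h_def c_def[symmetric] dF_def K.dF_def
  proof
    fix p
    show "(v (F w z u) - w (F v z u) + z (F v w u) - u (F v w z)
        - F (lie v w) z u + F (lie v z) w u - F (lie v u) w z
        - F (lie w z) v u + F (lie w u) v z - F (lie z u) v w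
      - (I v (F (I w) z u) - I w (F (I v) z u) + z (F (I v) (I w) u) - u (F (I v) (I w) z)
        - F (lie (I v) (I w)) z u + F (lie (I v) z) (I w) u - F (lie (I v) u) (I w) z
        - F (lie (I w) z) (I v) u + F (lie (I w) u) (I v) z - F (lie z u) (I v) (I w))
      + (I v (K w z u) - w (K (I v) z u) + z (K (I v) w u) - u (K (I v) w z)
        - K (lie (I v) w) z u + K (lie (I v) z) w u - K (lie (I v) u) w z
        - K (lie w z) (I v) u + K (lie w u) (I v) z - K (lie z u) (I v) w)
      + (v (K (I w) z u) - I w (K v z u) + z (K v (I w) u) - u (K v (I w) z)
        - K (lie v (I w)) z u + K (lie v z) (I w) u - K (lie v u) (I w) z
        - K (lie (I w) z) v u + K (lie (I w) u) v z - K (lie z u) v (I w))) p =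
      (v (h w z u) + I v (h w (I z) u) - h w (lie01 v z) u - h w z (lie01 v u)
      - (w (h v z u) + I w (h v (I z) u) - h v (lie01 w z) u - h v z (lie01 w u))
      - h c z u) p"
      using terms[THEN fun_cong, of p] unfolding pointwise by linarith
  qed
qed

text \<open>Project the identity \<open>dF_dK_eq_dbar_h\<close> to type (1,0) in \<open>z\<close> and \<open>u\<close>: on the side of \<open>dF\<close> and \<open>dK\<close>
  the vanishing (2,2) parts appear, with \<open>dK\<close> taken at \<open>I v\<close>, and on the other side
  \<open>dbar_h\<close> is reproduced four times.\<close>

theorem dbar_h_zero:
  assumes "dF_no_22_part" "K.dF_no_22_part" and VF: "v \<in> VF" "w \<in> VF" "z \<in> VF" "u \<in> VF"
  shows "dbar_h v w z u = 0"
proof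
  fix p
  have "dbar_h v w z u p - dbar_h v w (I z) (I u) p
      + dbar_h (I v) w (I z) u p + dbar_h (I v) w z (I u) p = 0"
    using VF dF_no_22_partD[OF assms(1) VF, THEN fun_cong, of p]
      K.dF_no_22_partD[OF assms(2) I_VF[OF VF(1)] VF(2-4), THEN fun_cong, of p]
    by (simp add: dF_dK_eq_dbar_h[symmetric] dF_uminus K.dF_uminus pointwise)
  then show "dbar_h v w z u p = 0 p"
    using VF by (simp add: dbar_h_I34 dbar_h_I13 dbar_h_I14 pointwise)
qed

end

section \<open>The modified connection\<close>

locale chern_form = chern \<A> g I D + form_21_12 \<A> g I F
  for \<A> :: "('m::{t2_space, second_countable_topology}, 'e::euclidean_space) atlas"
    and g I D F +
  fixes A :: "'m vfield \<Rightarrow> 'm vfield \<Rightarrow> 'm vfield"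
  assumes A_VF [simp]: "v \<in> VF \<Longrightarrow> w \<in> VF \<Longrightarrow> A v w \<in> VF"
    and g_A: "v \<in> VF \<Longrightarrow> w \<in> VF \<Longrightarrow> u \<in> VF \<Longrightarrow> g (A v w) u = F v w u"
begin

abbreviation half :: "'m \<Rightarrow> real" where "half \<equiv> (\<lambda>_. 1/2)"

definition T :: "'m vfield \<Rightarrow> 'm vfield \<Rightarrow> 'm vfield" where
  "T v w = half \<odot> I_comm I A v w"

lemma T_VF [simp]: "v \<in> VF \<Longrightarrow> w \<in> VF \<Longrightarrow> T v w \<in> VF"
  by (simp add: T_def I_comm_def)

text \<open>Lowering an index turns \<open>T\<close> into half of \<open>h\<close>; the algebraic properties of \<open>T\<close> below are those
  of \<open>h\<close>.\<close>

lemma g_T: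
  assumes "v \<in> VF" "w \<in> VF" "u \<in> VF"
  shows "g (T v w) u = half * h v w u"
  using assms
  by (simp add: T_def I_comm_def h_def I_diff g_scale_left g_linear g_I_left g_A)

lemma g_T_right:
  assumes "v \<in> VF" "w \<in> VF" "u \<in> VF"
  shows "g w (T v u) = - (half * h v w u)"
  using assms h_swap[of v u w] g_sym[of w "T v u"] by (simp add: g_T)

lemma T_add1: "v \<in> VF \<Longrightarrow> v' \<in> VF \<Longrightarrow> w \<in> VF \<Longrightarrow> T (v + v') w = T v w + T v' w"
  by (rule vfield_eqI) (simp_all add: g_T g_add_left h_linear distrib_left)

lemma T_add2: "v \<in> VF \<Longrightarrow> w \<in> VF \<Longrightarrow> w' \<in> VF \<Longrightarrow> T v (w + w') = T v w + T v w'"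
  by (rule vfield_eqI) (simp_all add: g_T g_add_left h_linear distrib_left)

lemma T_scale1: "smooth f \<Longrightarrow> v \<in> VF \<Longrightarrow> w \<in> VF \<Longrightarrow> T (f \<odot> v) w = f \<odot> T v w"
  by (rule vfield_eqI) (simp_all add: g_T g_scale_left h_def F_scale1 algebra_simps)

lemma T_scale2: "smooth f \<Longrightarrow> v \<in> VF \<Longrightarrow> w \<in> VF \<Longrightarrow> T v (f \<odot> w) = f \<odot> T v w"
  by (rule vfield_eqI) (simp_all add: g_T g_scale_left h_def I_scale F_scale2 algebra_simps)

lemma T_I1: "v \<in> VF \<Longrightarrow> w \<in> VF \<Longrightarrow> T (I v) w = I (T v w)"
  by (rule vfield_eqI) (simp_all add: g_T g_I_left h_I1 h_I3)

lemma T_I2: "v \<in> VF \<Longrightarrow> w \<in> VF \<Longrightarrow> T v (I w) = - I (T v w)"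
  by (rule vfield_eqI) (simp_all add: g_T g_uminus_left g_I_left h_I3)

text \<open>\<open>T\<close> is skew with respect to \<open>g\<close> because \<open>h\<close> is skew in its last two slots.\<close>

lemma metric_connection_modified: "metric_connection \<A> g (\<lambda>v w. D v w + T v w)"
  unfolding metric_connection_def connection_def
  by (auto simp: D_add_left D_add_right D_scale_left D_leibniz D_metric T_add1 T_add2 T_scale1
      T_scale2 g_add_left g_add_right g_T g_T_right vfield_eq_iff vfield_apply algebra_simps)

definition dT :: "'m vfield \<Rightarrow> 'm vfield \<Rightarrow> 'm vfield \<Rightarrow> 'm vfield" where
  "dT v w z = D v (T w z) + T v (D w z) - D w (T v z) - T w (D v z) - T (lie v w) z"

lemma dT_VF [simp]: "v \<in> VF \<Longrightarrow> w \<in> VF \<Longrightarrow> z \<in> VF \<Longrightarrow> dT v w z \<in> VF"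
  by (simp add: dT_def)

text \<open>Here \<open>dT\<close> is the exterior covariant derivative of the endomorphism-valued one-form \<open>T\<close>.\<close>

lemma curvature_modified:
  assumes "v \<in> VF" "w \<in> VF" "z \<in> VF"
  shows "curvature (\<lambda>v w. D v w + T v w) v w z
    = curvature D v w z + dT v w z + (T v (T w z) - T w (T v z))"
  using assms by (simp add: curvature_def dT_def D_linear T_add2 algebra_simps)

lemma g_dT:
  assumes "v \<in> VF" "w \<in> VF" "z \<in> VF" "u \<in> VF"
  shows "g (dT v w z) u = half * (v (h w z u) - h w z (D v u) - h w (D v z) u
    - (w (h v z u) - h v z (D w u) - h v (D w z) u) - h (lie v w) z u)"
proof -
  have g_D: "g (D x (T y z)) u = half * (x (h y z u) - h y z (D x u))"
    if "x \<in> VF" "y \<in> VF" for x y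
  proof -
    have "g (D x (T y z)) u = x (g (T y z) u) - g (T y z) (D x u)"
      using that assms by (simp add: D_metric)
    then show ?thesis using that assms by (simp add: g_T vf_scale right_diff_distrib)
  qed
  show ?thesis
    using assms by (simp add: dT_def g_linear g_D g_T algebra_simps)
qed

text \<open>The (0,1) part of \<open>D\<close> is \<open>lie01\<close> by \<open>D_01_eq_lie\<close>, so the difference of the two
  sides, paired with \<open>u\<close>, becomes half of \<open>dbar_h\<close>.\<close>

lemma dT_11:
  assumes "dF_no_22_part" "K.dF_no_22_part" and VF: "v \<in> VF" "w \<in> VF" "z \<in> VF"
  shows "dT (I v) (I w) z = dT v w z"
proof (rule vfield_eqI)
  fix u assume u: "u \<in> VF"
  have "g (dT v w z) u - g (dT (I v) (I w) z) u = half * dbar_h v w z u"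
    using VF u
    by (simp add: g_dT dbar_h_def lie01_def D_01_eq_lie[symmetric] h_I1 h_I3 h_linear vf_uminus
        algebra_simps)
  then show "g (dT (I v) (I w) z) u = g (dT v w z) u"
    using dbar_h_zero[OF assms u] by simp
qed (use VF in simp_all)

theorem curvature_11_modified:
  assumes "dF_no_22_part" "K.dF_no_22_part"
  shows "curvature_11 \<A> I (\<lambda>v w. D v w + T v w)"
  unfolding curvature_11_def
proof (intro ballI)
  fix v w z assume VF: "v \<in> VF" "w \<in> VF" "z \<in> VF"
  \<comment> \<open>The two signs from moving \<open>I\<close> through \<open>T\<close> cancel.\<close>
  have "T (I v) (T (I w) z) = T v (T w z)" if "v \<in> VF" "w \<in> VF" for v w
    using that VF(3) by (simp add: T_I1 T_I2 I_uminus)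
  then show "curvature (\<lambda>v w. D v w + T v w) (I v) (I w) z
      = curvature (\<lambda>v w. D v w + T v w) v w z"
    using VF by (simp add: curvature_modified chern_curvature_11 dT_11[OF assms])
qed

end

section \<open>Type decomposition in real terms\<close>

text \<open>Evaluation on complex vector fields sums over subsets of slots; this recursion lists them.\<close>

lemma sum_Pow_lessThan_Suc:
  fixes f :: "nat set \<Rightarrow> 'a::comm_monoid_add"
  shows "(\<Sum>S\<in>Pow {..<Suc n}. f S) = (\<Sum>S\<in>Pow {..<n}. f S + f (insert n S))"
proof -
  have "inj_on (insert n) (Pow {..<n})"
    by (auto simp: inj_on_def insert_eq_iff)
  moreover have "Pow {..<n} \<inter> insert n ` Pow {..<n} = {}" by auto
  ultimately show ?thesis
    by (simp add: lessThan_Suc Pow_insert sum.union_disjoint sum.reindex sum.distrib)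
qed

lemma sum_Pow_lessThan_0: "(\<Sum>S\<in>Pow {..<0::nat}. f S) = f {}"
  by simp

context hermitian
begin

text \<open>The projections of a real vector field to type (1,0) and (0,1) differ only in the sign \<open>s\<close> of
  the imaginary part, so one formula covers all the slots of a type decomposition.\<close>

definition split_part :: "real \<Rightarrow> 'm vfield \<Rightarrow> 'm cvfield" where
  "split_part s X = ((\<lambda>_. 1/2) \<odot> X, (\<lambda>_. s/2) \<odot> I X)"

lemma proj_real: 
  "proj10 I (X, 0) = split_part (-1) X" "proj01 I (X, 0) = split_part 1 X"
  by (simp_all add: proj10_def proj01_def split_part_def cv_half_def cv_i_def vfield_eq_iff
    vfield_apply fun_eq_iff pointwise)

text \<open>Homogeneity over real constants in each slot serves to pull the factors \<open>1/2\<close> and \<open>s/2\<close> of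
  \<open>split_part\<close> out of a form.\<close>

definition homogeneous3 :: "('m vfield list \<Rightarrow> ('m \<Rightarrow> complex)) \<Rightarrow> 'm \<Rightarrow> bool" where
  "homogeneous3 \<alpha> x \<longleftrightarrow> (\<forall>c. \<forall>a\<in>VF. \<forall>b\<in>VF. \<forall>d\<in>VF.
     \<alpha> [(\<lambda>_. c) \<odot> a, b, d] x = of_real c * \<alpha> [a, b, d] x \<and>
     \<alpha> [a, (\<lambda>_. c) \<odot> b, d] x = of_real c * \<alpha> [a, b, d] x \<and>
     \<alpha> [a, b, (\<lambda>_. c) \<odot> d] x = of_real c * \<alpha> [a, b, d] x)"

definition homogeneous4 :: "('m vfield list \<Rightarrow> ('m \<Rightarrow> complex)) \<Rightarrow> 'm \<Rightarrow> bool" where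
  "homogeneous4 \<alpha> x \<longleftrightarrow> (\<forall>c. \<forall>a\<in>VF. \<forall>b\<in>VF. \<forall>d\<in>VF. \<forall>e\<in>VF.
     \<alpha> [(\<lambda>_. c) \<odot> a, b, d, e] x = of_real c * \<alpha> [a, b, d, e] x \<and>
     \<alpha> [a, (\<lambda>_. c) \<odot> b, d, e] x = of_real c * \<alpha> [a, b, d, e] x \<and>
     \<alpha> [a, b, (\<lambda>_. c) \<odot> d, e] x = of_real c * \<alpha> [a, b, d, e] x \<and>
     \<alpha> [a, b, d, (\<lambda>_. c) \<odot> e] x = of_real c * \<alpha> [a, b, d, e] x)"

lemma cv_eval_split3:
  assumes scale: "homogeneous3 \<alpha> x"
    and VF: "a \<in> VF" "b \<in> VF" "d \<in> VF"
  shows "cv_eval \<alpha> [split_part r a, split_part s b, split_part t d] x =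
    (\<alpha> [a, b, d] x
      + \<i> * (r * \<alpha> [I a, b, d] x + s * \<alpha> [a, I b, d] x + t * \<alpha> [a, b, I d] x)
      - (r * s * \<alpha> [I a, I b, d] x + r * t * \<alpha> [I a, b, I d] x + s * t * \<alpha> [a, I b, I d] x)
      - \<i> * (r * s * t * \<alpha> [I a, I b, I d] x)) / 8"
proof -
  have "Pow {..<3::nat} = Pow {..<Suc (Suc (Suc 0))}" by (simp add: numeral_3_eq_3)
  then show ?thesis using VF
    by (simp add: cv_eval_def sum_Pow_lessThan_Suc split_part_def scale[unfolded homogeneous3_def] upt_rec power3_eq_cube field_simps)
qed

lemma sum_card_Pow:
  "(\<Sum>S | S \<subseteq> {..<n::nat} \<and> card S = p. f S) = (\<Sum>S\<in>Pow {..<n}. if card S = p then f S else 0)"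
  using sum.inter_filter[of "Pow {..<n}" f "\<lambda>S. card S = p"] by (simp add: Pow_def)

lemma sum_subsets_3_2:
  fixes f :: "nat set \<Rightarrow> 'a::comm_monoid_add"
  shows "(\<Sum>S | S \<subseteq> {..<Suc (Suc (Suc 0))} \<and> card S = 2. f S)
    = f {Suc 0, 0} + f {Suc (Suc 0), 0} + f {Suc (Suc 0), Suc 0}"
  unfolding sum_card_Pow sum_Pow_lessThan_Suc by (simp add: numeral_2_eq_2 ac_simps)

lemma sum_subsets_4_2:
  fixes f :: "nat set \<Rightarrow> 'a::comm_monoid_add"
  shows "(\<Sum>S | S \<subseteq> {..<Suc (Suc (Suc (Suc 0)))} \<and> card S = 2. f S)
    = f {Suc 0, 0} + f {Suc (Suc 0), 0} + f {Suc (Suc 0), Suc 0}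
      + f {Suc (Suc (Suc 0)), 0} + f {Suc (Suc (Suc 0)), Suc 0}
      + f {Suc (Suc (Suc 0)), Suc (Suc 0)}"
  unfolding sum_card_Pow sum_Pow_lessThan_Suc by (simp add: numeral_2_eq_2 ac_simps)

lemma cv_eval4:
  fixes P Q R S :: "'m cvfield"
  shows "cv_eval \<alpha> [P, Q, R, S] x =
    \<alpha> [fst P, fst Q, fst R, fst S] x
    + \<i> * (\<alpha> [snd P, fst Q, fst R, fst S] x + \<alpha> [fst P, snd Q, fst R, fst S] x
      + \<alpha> [fst P, fst Q, snd R, fst S] x + \<alpha> [fst P, fst Q, fst R, snd S] x)
    - (\<alpha> [snd P, snd Q, fst R, fst S] x + \<alpha> [snd P, fst Q, snd R, fst S] x
      + \<alpha> [snd P, fst Q, fst R, snd S] x + \<alpha> [fst P, snd Q, snd R, fst S] x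
      + \<alpha> [fst P, snd Q, fst R, snd S] x + \<alpha> [fst P, fst Q, snd R, snd S] x)
    - \<i> * (\<alpha> [snd P, snd Q, snd R, fst S] x + \<alpha> [snd P, snd Q, fst R, snd S] x
      + \<alpha> [snd P, fst Q, snd R, snd S] x + \<alpha> [fst P, snd Q, snd R, snd S] x)
    + \<alpha> [snd P, snd Q, snd R, snd S] x"
proof -
  have len: "length [P, Q, R, S] = Suc (Suc (Suc (Suc 0)))" by simp
  show ?thesis
    unfolding cv_eval_def len sum_Pow_lessThan_Suc sum_Pow_lessThan_0
    by (simp add: upt_rec algebra_simps)
qed

lemma cv_eval_split4:
  assumes scale: "homogeneous4 \<alpha> x"
    and VF: "a \<in> VF" "b \<in> VF" "d \<in> VF" "e \<in> VF"
  shows "cv_eval \<alpha> [split_part r a, split_part s b, split_part t d, split_part q e] x =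
    (\<alpha> [a, b, d, e] x
      + \<i> * (r * \<alpha> [I a, b, d, e] x + s * \<alpha> [a, I b, d, e] x + t * \<alpha> [a, b, I d, e] x
          + q * \<alpha> [a, b, d, I e] x)
      - (r * s * \<alpha> [I a, I b, d, e] x + r * t * \<alpha> [I a, b, I d, e] x
          + r * q * \<alpha> [I a, b, d, I e] x + s * t * \<alpha> [a, I b, I d, e] x
          + s * q * \<alpha> [a, I b, d, I e] x + t * q * \<alpha> [a, b, I d, I e] x)
      - \<i> * (r * s * t * \<alpha> [I a, I b, I d, e] x + r * s * q * \<alpha> [I a, I b, d, I e] x
          + r * t * q * \<alpha> [I a, b, I d, I e] x + s * t * q * \<alpha> [a, I b, I d, I e] x)
      + r * s * t * q * \<alpha> [I a, I b, I d, I e] x) / 16"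
  using VF
  by (simp add: cv_eval4 split_part_def scale[unfolded homogeneous4_def] field_simps)

text \<open>The coefficients are sums over the three choices of the (0,1) slot: inserting \<open>I\<close> in \<open>k\<close> slots
  contributes \<open>\<i> ^ k\<close> times the sum of the products of signs, with sign -1 on (1,0) slots.\<close>

lemma type_part_2_1:
  assumes "homogeneous3 \<alpha> x"
    and "a \<in> VF" "b \<in> VF" "d \<in> VF"
  shows "type_part I 2 1 \<alpha> [a, b, d] x =
    (3 * \<alpha> [a, b, d] x + \<alpha> [I a, I b, d] x + \<alpha> [I a, b, I d] x + \<alpha> [a, I b, I d] x
      - \<i> * (\<alpha> [I a, b, d] x + \<alpha> [a, I b, d] x + \<alpha> [a, b, I d] x
          + 3 * \<alpha> [I a, I b, I d] x)) / 8"
  using assms(2-)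
  by (simp add: type_part_def sum_subsets_3_2 upt_rec proj_real cv_eval_split3[OF assms(1)] field_simps)

text \<open>As for type (2,1), now over the six choices of two (1,0) slots; insertions in an odd number of
  slots cancel, as the choice and its complement have opposite signs.\<close>

lemma type_part_2_2:
  assumes "homogeneous4 \<alpha> x"
    and "a \<in> VF" "b \<in> VF" "d \<in> VF" "e \<in> VF"
  shows "type_part I 2 2 \<alpha> [a, b, d, e] x =
    (3 * \<alpha> [a, b, d, e] x
      + \<alpha> [I a, I b, d, e] x + \<alpha> [I a, b, I d, e] x + \<alpha> [I a, b, d, I e] x
      + \<alpha> [a, I b, I d, e] x + \<alpha> [a, I b, d, I e] x + \<alpha> [a, b, I d, I e] x
      + 3 * \<alpha> [I a, I b, I d, I e] x) / 8"
  using assms(2-)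
  by (simp add: type_part_def eval_nat_numeral sum_subsets_4_2[unfolded numeral_2_eq_2] upt_rec proj_real cv_eval_split4[OF assms(1)] field_simps)

text \<open>A \<open>k_form\<close> vanishes on repeated arguments; antisymmetry follows by polarisation.\<close>

lemma three_form_of_k_form:
  assumes H: "k_form \<A> 3 H"
  shows "three_form \<A> g I (\<lambda>x y z. H [x, y, z])"
proof -
  have form: "smooth (H [x, y, z])"
      "x' \<in> VF \<Longrightarrow> H [x + x', y, z] = H [x, y, z] + H [x', y, z]"
      "y' \<in> VF \<Longrightarrow> H [x, y + y', z] = H [x, y, z] + H [x, y', z]"
      "z' \<in> VF \<Longrightarrow> H [x, y, z + z'] = H [x, y, z] + H [x, y, z']"
      "smooth f \<Longrightarrow> H [f \<odot> x, y, z] = f * H [x, y, z]"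
      "H [x, x, z] = 0" "H [x, y, y] = 0"
    if VF: "x \<in> VF" "y \<in> VF" "z \<in> VF" for x y z x' y' z' f
  proof -
    note * = H[unfolded k_form_def, rule_format, of "[x, y, z]", THEN conjunct2, THEN conjunct1,
        rule_format]
    note ** = H[unfolded k_form_def, rule_format, of "[x, y, z]", THEN conjunct2, THEN conjunct2,
        THEN conjunct1, rule_format]
    note alt = H[unfolded k_form_def, rule_format, THEN conjunct2, THEN conjunct2, THEN conjunct2,
        rule_format]
    show "smooth (H [x, y, z])"
      using H VF by (simp add: k_form_def)
    show "H [x + x', y, z] = H [x, y, z] + H [x', y, z]" if "x' \<in> VF"
      using *[where i = 0 and X = x and Y = x'] VF that by simp
    show "H [x, y + y', z] = H [x, y, z] + H [x, y', z]" if "y' \<in> VF"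
      using *[where i = 1 and X = y and Y = y'] VF that by simp
    show "H [x, y, z + z'] = H [x, y, z] + H [x, y, z']" if "z' \<in> VF"
      using *[where i = 2 and X = z and Y = z'] VF that by (simp add: numeral_2_eq_2)
    show "H [f \<odot> x, y, z] = f * H [x, y, z]" if "smooth f"
      using **[where i = 0 and h = f and X = x] VF that by simp
    show "H [x, x, z] = 0"
      using alt[where Xs = "[x, x, z]" and i = 0 and j = 1] VF by simp
    show "H [x, y, y] = 0"
      using alt[where Xs = "[x, y, y]" and i = 1 and j = 2] VF by simp
  qed
  show ?thesis
  proof
    fix x y z assume VF: "x \<in> VF" "y \<in> VF" "z \<in> VF"
    have "0 = H [x + y, x + y, z]" "0 = H [x, y + z, y + z]"
      using VF by (simp_all add: form(6,7))
    moreover have "H [x + y, x + y, z] = H [x, y, z] + H [y, x, z]"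
        "H [x, y + z, y + z] = H [x, y, z] + H [x, z, y]"
      using VF form(6)[OF VF(1) _ VF(3), of x] form(6)[OF VF(2) _ VF(3), of y]
        form(7)[OF VF(1,2), of y] form(7)[OF VF(1,3), of z]
      by (simp_all add: form(2,3,4))
    ultimately show "H [x, y, z] = - H [y, x, z]" "H [x, y, z] = - H [x, z, y]"
      by (simp_all add: eq_neg_iff_add_eq_0)
  qed (simp_all add: form)
qed

end

context three_form
begin

lemma type_part_2_1_complexify:
  assumes H: "\<And>x y z. H [x, y, z] = F x y z" and "x \<in> VF" "y \<in> VF" "z \<in> VF"
  shows "type_part I 2 1 (complexify H) [x, y, z] p = Complex
     ((3 * F x y z p + F (I x) (I y) z p + F (I x) y (I z) p + F x (I y) (I z) p) / 8)
     (- (F (I x) y z p + F x (I y) z p + F x y (I z) p + 3 * F (I x) (I y) (I z) p) / 8)"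
  using assms(2-)
  by (subst type_part_2_1) (simp_all add: homogeneous3_def complexify_def H F_scale1 F_scale2 F_scale3 pointwise
    complex_eq_iff)

end

context form_21_12
begin

lemma ext_d_21_part:
  assumes \<theta>: "\<And>x y z p. x \<in> VF \<Longrightarrow> y \<in> VF \<Longrightarrow> z \<in> VF \<Longrightarrow>
      \<theta> [x, y, z] p = Complex (F x y z p / 2) (- K x y z p / 2)"
    and VF: "v \<in> VF" "w \<in> VF" "z \<in> VF" "u \<in> VF"
  shows "ext_d \<theta> [v, w, z, u] p = Complex (dF v w z u p / 2) (- dK v w z u p / 2)"
proof -
  have act: "vf_act s (\<theta> [x, y, t]) p = Complex (s (F x y t) p / 2) (- s (K x y t) p / 2)"
    if "s \<in> VF" "x \<in> VF" "y \<in> VF" "t \<in> VF" for s x y t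
  proof -
    have "(\<lambda>q. Re (\<theta> [x, y, t] q)) = (\<lambda>_. 1/2) * F x y t"
      and "(\<lambda>q. Im (\<theta> [x, y, t] q)) = (\<lambda>_. -1/2) * K x y t"
      using that by (simp_all add: \<theta> fun_eq_iff pointwise)
    then show ?thesis using that by (simp add: vf_act_def vf_scale pointwise)
  qed
  show ?thesis
    using VF
    by (simp add: ext_d_def numeral_eq_Suc lessThan_Suc nths_Cons act \<theta> dF_def K.dF_def pointwise
        complex_eq_iff field_simps)
qed

text \<open>For \<open>\<theta> = (F - \<i> K) / 2\<close> the exterior derivative has real part \<open>dF / 2\<close> and imaginary part
  \<open>- dK / 2\<close>. The projection to type (2,2) has real coefficients, so the Dolbeault condition on
  \<open>\<theta>\<close> holds separately for \<open>dF\<close> and \<open>dK\<close>.\<close>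

lemma dF_no_22_part_if_dbar_zero:
  assumes \<theta>: "\<And>x y z p. x \<in> VF \<Longrightarrow> y \<in> VF \<Longrightarrow> z \<in> VF \<Longrightarrow>
      \<theta> [x, y, z] p = Complex (F x y z p / 2) (- K x y z p / 2)"
    and dbar: "\<And>v w z u. v \<in> VF \<Longrightarrow> w \<in> VF \<Longrightarrow> z \<in> VF \<Longrightarrow> u \<in> VF \<Longrightarrow>
      dbar I 2 1 \<theta> [v, w, z, u] = 0"
  shows "dF_no_22_part" "K.dF_no_22_part"
proof -
  have *: "type_part I 2 2 (ext_d \<theta>) [v, w, z, u] p = 0"
    if "v \<in> VF" "w \<in> VF" "z \<in> VF" "u \<in> VF" for v w z u p
    using dbar[OF that] by (simp add: dbar_def fun_eq_iff pointwise numeral_2_eq_2)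
  have **: "type_part I 2 2 (ext_d \<theta>) [a, b, d, e] x =
    (3 * ext_d \<theta> [a, b, d, e] x
      + ext_d \<theta> [I a, I b, d, e] x + ext_d \<theta> [I a, b, I d, e] x + ext_d \<theta> [I a, b, d, I e] x
      + ext_d \<theta> [a, I b, I d, e] x + ext_d \<theta> [a, I b, d, I e] x + ext_d \<theta> [a, b, I d, I e] x
      + 3 * ext_d \<theta> [I a, I b, I d, I e] x) / 8"
    if "a \<in> VF" "b \<in> VF" "d \<in> VF" "e \<in> VF" for a b d e x
    using that
    by (intro type_part_2_2) (simp_all add: homogeneous4_def ext_d_21_part[OF \<theta>] dF_scale1 dF_scale2 dF_scale3
      dF_scale4 K.dF_scale1 K.dF_scale2 K.dF_scale3 K.dF_scale4 pointwise complex_eq_iff)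
  have "Complex
      (3 * dF v w z u p + dF (I v) (I w) z u p + dF (I v) w (I z) u p + dF (I v) w z (I u) p
        + dF v (I w) (I z) u p + dF v (I w) z (I u) p + dF v w (I z) (I u) p
        + 3 * dF (I v) (I w) (I z) (I u) p)
      (- (3 * dK v w z u p + dK (I v) (I w) z u p + dK (I v) w (I z) u p + dK (I v) w z (I u) p
        + dK v (I w) (I z) u p + dK v (I w) z (I u) p + dK v w (I z) (I u) p
        + 3 * dK (I v) (I w) (I z) (I u) p)) = 0"
    if "v \<in> VF" "w \<in> VF" "z \<in> VF" "u \<in> VF" for v w z u p
    using *[OF that, of p] that by (simp add: ** ext_d_21_part[OF \<theta>] complex_eq_iff field_simps)
  then show "dF_no_22_part" "K.dF_no_22_part"
    unfolding dF_no_22_part_def K.dF_no_22_part_def complex_eq_iff complex.sel zero_complex.sel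
      neg_equal_0_iff_equal by blast+
qed

end

section \<open>Metric connections with (1,1) curvature\<close>

theorem proposition3p5:
  fixes \<A> :: "('m::{t2_space, second_countable_topology}, 'e::euclidean_space) atlas"
    and g :: "'m vfield \<Rightarrow> 'm vfield \<Rightarrow> ('m \<Rightarrow> real)"
    and I :: "'m vfield \<Rightarrow> 'm vfield"
    and H :: "'m vfield list \<Rightarrow> ('m \<Rightarrow> real)"
    and D A :: "'m vfield \<Rightarrow> 'm vfield \<Rightarrow> 'm vfield"
  defines "H21 \<equiv> type_part I 2 1 (complexify H)"
  assumes "hermitian_manifold \<A> g I"
    and "k_form \<A> 3 H"
    and "\<And>X Y Z x. X \<in> vector_fields \<A> \<Longrightarrow> Y \<in> vector_fields \<A> \<Longrightarrow> Z \<in> vector_fields \<A> \<Longrightarrow>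
           complex_of_real (H [X, Y, Z] x) = H21 [X, Y, Z] x + cnj (H21 [X, Y, Z] x)"
    and "\<And>X Y Z W. X \<in> vector_fields \<A> \<Longrightarrow> Y \<in> vector_fields \<A> \<Longrightarrow> Z \<in> vector_fields \<A> \<Longrightarrow>
           W \<in> vector_fields \<A> \<Longrightarrow> dbar I 2 1 H21 [X, Y, Z, W] = 0"
    and "chern_connection \<A> g I D"
    and "is_ginv \<A> g H A"
  defines "D' \<equiv> \<lambda>v w. D v w + (\<lambda>_. 1/2) \<odot> I_comm I A v w"
  shows "metric_connection \<A> g D' \<and> curvature_11 \<A> I D'"
proof -
  define F where "F x y z = H [x, y, z]" for x y z
  interpret hermitian \<A> g I
    using assms(2) by unfold_locales (simp_all add: hermitian_manifold_def)
  interpret three_form \<A> g I F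
    unfolding F_def by (rule three_form_of_k_form[OF assms(3)])
  have H21: "H21 [x, y, z] p = Complex
     ((3 * F x y z p + F (I x) (I y) z p + F (I x) y (I z) p + F x (I y) (I z) p) / 8)
     (- (F (I x) y z p + F x (I y) z p + F x y (I z) p + 3 * F (I x) (I y) (I z) p) / 8)"
    if "x \<in> VF" "y \<in> VF" "z \<in> VF" for x y z p
    unfolding H21_def using that by (intro type_part_2_1_complexify) (simp_all add: F_def)
  \<comment> \<open>\<open>F = 2 Re H21\<close> with the explicit real part of \<open>type_part_2_1_complexify\<close> is an equation for
    \<open>F\<close> whose solution is the real condition for type (2,1) + (1,2).\<close>
  have solve: "f = a + b + c" if "f = 2 * ((3 * f + a + b + c) / 8)" for f a b c :: real
    using that by simp
  have type: "F x y z = F (I x) (I y) z + F (I x) y (I z) + F x (I y) (I z)"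
    if "x \<in> VF" "y \<in> VF" "z \<in> VF" for x y z
  proof
    fix p
    have *: "F x y z p = 2 * Re (H21 [x, y, z] p)"
      unfolding F_def using arg_cong[OF assms(4)[OF that, of p], of Re]
      by (simp only: complex.sel plus_complex.sel complex_cnj Re_complex_of_real cnj.sel mult_2)
    show "F x y z p = (F (I x) (I y) z + F (I x) y (I z) + F x (I y) (I z)) p"
      using solve[OF *[unfolded H21[OF that] complex.sel]] unfolding pointwise .
  qed
  interpret chern_form \<A> g I D F A
    using assms(6,7) by unfold_locales (auto simp: is_ginv_def F_def intro: type[unfolded F_def])
  \<comment> \<open>The type condition at \<open>x, y, z\<close> gives the real part, and at \<open>I x, I y, I z\<close> the imaginary part.\<close>
  have H21_FK: "H21 [x, y, z] p = Complex (F x y z p / 2) (- K x y z p / 2)"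
    if "x \<in> VF" "y \<in> VF" "z \<in> VF" for x y z p
    using that type[OF that, THEN fun_cong, of p]
      type[OF I_VF[OF that(1)] I_VF[OF that(2)] I_VF[OF that(3)], THEN fun_cong, of p]
    by (simp add: H21 K_def F_linear pointwise)
  have "dF_no_22_part" "K.dF_no_22_part"
    using dF_no_22_part_if_dbar_zero[of H21, OF H21_FK assms(5)] by simp_all
  then have "curvature_11 \<A> I (\<lambda>v w. D v w + T v w)"
    by (rule curvature_11_modified)
  then show ?thesis
    using metric_connection_modified by (simp add: D'_def T_def)
qed

end
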